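(* Let $n\ge 1$, let $a\in\mathbb{R}^n$, let $t\in\mathbb{R}$ with $t\neq 0$, and let $\rho\in L^1(\mathbb{R}^n)$ satisfy $\rho\ge 0$, $\sqrt{\rho}\in L^1(\mathbb{R}^n)$ and $\int_{\mathbb{R}^n}\rho(x)\,dx=1$. For $\varepsilon\in(0,1]$ let $\mu^t_\varepsilon$ be the Borel probability measure on $\mathbb{R}^n$ with Lebesgue density $|u_\varepsilon(\cdot,t)|^2$, where $u_\varepsilon(\cdot,t)=e^{it\Delta}\sqrt{\delta_a*\rho_\varepsilon}$, i.e. $u_\varepsilon$ is the $L^2$-solution of $\partial_t u_\varepsilon=i\Delta u_\varepsilon$ with initial value $u_\varepsilon|_{t=0}=\sqrt{\rho_\varepsilon(\cdot-a)}$. Then for every almost periodic function $f\in AP(\mathbb{R}^n)$, $$\lim_{\varepsilon\to 0}\int_{\mathbb{R}^n} f\,d\mu^t_\varepsilon = m(f),$$ where $m\colon AP(\mathbb{R}^n)\to\mathbb{C}$ is the unique invariant mean on $AP(\mathbb{R}^n)$.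
   Context: Notation: $\rho_\varepsilon(x)=\varepsilon^{-n}\rho(x/\varepsilon)$ for $\varepsilon\in(0,1]$; $\delta_a$ is the Dirac measure at $a$, so $(\delta_a*\rho_\varepsilon)(x)=\rho_\varepsilon(x-a)$. $(e^{it\Delta})_{t\in\mathbb{R}}$ is the strongly continuous unitary group on $L^2(\mathbb{R}^n)$ generated by the Laplacian with domain $H^2(\mathbb{R}^n)$; with the Fourier transform $\mathcal{F}g(\xi)=\int_{\mathbb{R}^n} e^{-i\langle x,\xi\rangle}g(x)\,dx$ (extended to $L^2$) it is given by $\mathcal{F}(e^{it\Delta}g)(\xi)=e^{-it|\xi|^2}\mathcal{F}g(\xi)$. Since $\sqrt{\rho_\varepsilon(\cdot-a)}$ has $L^2$-norm $1$, $\mu^t_\varepsilon$ is a probability measure. $AP(\mathbb{R}^n)$, the space of almost periodic functions, is the closure, with respect to the supremum norm in the space $C_b(\mathbb{R}^n)$ of bounded continuous complex-valued functions, of the linear span of the characters $x\mapsto e^{i\langle x,\xi\rangle}$ ($\xi\in\mathbb{R}^n$). The invariant mean $m$ on $AP(\mathbb{R}^n)$ is the unique linear functional $m\colon AP(\mathbb{R}^n)\to\mathbb{C}$ that is positive ($m(f)\ge0$ if $f\ge0$), normalized ($m(1)=1$), and invariant under translations ($m(f(\cdot-z))=m(f)$ for all $z\in\mathbb{R}^n$). *)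

theory Defs
  imports "HOL-Analysis.Analysis"
begin

text \<open>
  Elements of \<open>L\<^sup>1\<close> and \<open>L\<^sup>2\<close> are represented by Borel functions, with identities understood
  almost everywhere.
\<close>

definition L2_sqnorm :: "('a::euclidean_space \<Rightarrow> complex) \<Rightarrow> ennreal" where
  "L2_sqnorm g = (\<integral>\<^sup>+ x. ennreal ((cmod (g x))\<^sup>2) \<partial>lborel)"

definition square_integrable :: "('a::euclidean_space \<Rightarrow> complex) \<Rightarrow> bool" where
  "square_integrable g \<longleftrightarrow> g \<in> borel_measurable lborel \<and> L2_sqnorm g < \<infinity>"

definition fourier :: "('a::euclidean_space \<Rightarrow> complex) \<Rightarrow> 'a \<Rightarrow> complex" where
  "fourier g \<xi> = (\<integral>x. exp (- \<i> * complex_of_real (x \<bullet> \<xi>)) * g x \<partial>lborel)"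

text \<open>
  \<open>has_L2_fourier g h\<close>: \<open>h\<close> is (a representative of) the \<open>L\<^sup>2\<close> Fourier transform of \<open>g\<close>, that is, the
  value at \<open>g\<close> of the continuous extension of \<^const>\<open>fourier\<close> from \<open>L\<^sup>1 \<inter> L\<^sup>2\<close> to \<open>L\<^sup>2\<close>. By
  Plancherel's theorem, \<open>h\<close> exists, is unique up to null sets, and does not depend on the
  approximating sequence.
\<close>

definition has_L2_fourier ::
  "('a::euclidean_space \<Rightarrow> complex) \<Rightarrow> ('a \<Rightarrow> complex) \<Rightarrow> bool" where
  "has_L2_fourier g h \<longleftrightarrow>
     square_integrable g \<and> square_integrable h \<and>
     (\<exists>s :: nat \<Rightarrow> 'a \<Rightarrow> complex.
        (\<forall>k. integrable lborel (s k) \<and> square_integrable (s k)) \<and>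
        (\<lambda>k. L2_sqnorm (\<lambda>x. s k x - g x)) \<longlonglongrightarrow> 0 \<and>
        (\<lambda>k. L2_sqnorm (\<lambda>\<xi>. fourier (s k) \<xi> - h \<xi>)) \<longlonglongrightarrow> 0)"

text \<open>
  A representative of \<open>e\<^bsup>it\<Delta>\<^esup> g\<close> for square integrable \<open>g\<close>; the choice operator selects only among
  functions that agree almost everywhere.
\<close>

definition schroedinger_group ::
  "real \<Rightarrow> ('a::euclidean_space \<Rightarrow> complex) \<Rightarrow> 'a \<Rightarrow> complex" where
  "schroedinger_group t g =
     (SOME u. \<exists>h. has_L2_fourier g h \<and>
        has_L2_fourier u (\<lambda>\<xi>. exp (- \<i> * complex_of_real (t * (norm \<xi>)\<^sup>2)) * h \<xi>))"

definition rescaled :: "real \<Rightarrow> ('a::euclidean_space \<Rightarrow> real) \<Rightarrow> 'a \<Rightarrow> real" where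
  "rescaled \<epsilon> \<rho> x = \<rho> (x /\<^sub>R \<epsilon>) / \<epsilon> ^ DIM('a)"

definition schroedinger_measure ::
  "('a::euclidean_space \<Rightarrow> real) \<Rightarrow> 'a \<Rightarrow> real \<Rightarrow> real \<Rightarrow> 'a measure" where
  "schroedinger_measure \<rho> a t \<epsilon> =
     density lborel (\<lambda>x. ennreal ((cmod (schroedinger_group t
       (\<lambda>y. complex_of_real (sqrt (rescaled \<epsilon> \<rho> (y - a)))) x))\<^sup>2))"

definition trig_polynomials :: "('a::euclidean_space \<Rightarrow> complex) set" where
  "trig_polynomials =
     {p. \<exists>(\<Xi>::'a set) c. finite \<Xi> \<and>
         p = (\<lambda>x. \<Sum>\<xi>\<in>\<Xi>. c \<xi> * exp (\<i> * complex_of_real (x \<bullet> \<xi>)))}"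

text \<open>
  The type \<^typ>\<open>'a \<Rightarrow>\<^sub>C complex\<close> is the space of bounded continuous functions with the supremum
  norm, so \<^const>\<open>closure\<close> is taken with respect to that norm.
\<close>

definition almost_periodic :: "('a::euclidean_space \<Rightarrow> complex) set" where
  "almost_periodic =
     apply_bcontfun ` closure {p :: 'a \<Rightarrow>\<^sub>C complex. apply_bcontfun p \<in> trig_polynomials}"

definition is_invariant_mean :: "(('a::euclidean_space \<Rightarrow> complex) \<Rightarrow> complex) \<Rightarrow> bool" where
  "is_invariant_mean m \<longleftrightarrow>
     (\<forall>f\<in>almost_periodic. \<forall>g\<in>almost_periodic. m (\<lambda>x. f x + g x) = m f + m g) \<and>
     (\<forall>c. \<forall>f\<in>almost_periodic. m (\<lambda>x. c * f x) = c * m f) \<and>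
     (\<forall>f\<in>almost_periodic. (\<forall>x. f x \<in> \<real>\<^sub>\<ge>\<^sub>0) \<longrightarrow> m f \<in> \<real>\<^sub>\<ge>\<^sub>0) \<and>
     m (\<lambda>x. 1) = 1 \<and>
     (\<forall>f\<in>almost_periodic. \<forall>z. m (\<lambda>x. f (x - z)) = m f)"

text \<open>
  Being extensional makes a functional on the almost periodic functions a unique HOL function, so
  that the definite description can be used.
\<close>

definition invariant_mean :: "('a::euclidean_space \<Rightarrow> complex) \<Rightarrow> complex" where
  "invariant_mean = (THE m. m \<in> extensional almost_periodic \<and> is_invariant_mean m)"

end

theory Submission
  imports Defs "HOL-Probability.Characteristic_Functions"
begin

text \<open>
  Let \<open>g\<close> be the initial value, \<open>h\<close> its Fourier transform and \<open>u = e\<^bsup>it\<Delta>\<^esup> g\<close>. On the Fourier side, multiplying \<open>u\<close> by the character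
  with frequency \<open>\<eta>\<close> shifts \<open>e\<^bsup>-it|\<xi>|^2\<^esup> h(\<xi>)\<close> by \<open>\<eta>\<close>, and \<open>|\<xi> - \<eta>|^2 - |\<xi>|^2\<close> is affine in \<open>\<xi>\<close>. Parseval's identity
  therefore turns \<open>\<integral> e\<^bsup>i\<langle>x,\<eta>\<rangle>\<^esup> |u|^2\<close> into a unimodular factor times the overlap of a modulation of \<open>g\<close> with
  its translate by \<open>2t\<eta>\<close>; no formula for the Schroedinger kernel is needed. After rescaling, the modulus is at
  most the overlap of \<open>sqrt \<rho>\<close> with its translate by \<open>2t\<eta>/\<epsilon>\<close>, which vanishes as \<open>\<epsilon> \<rightarrow> 0\<close> unless \<open>\<eta> = 0\<close>. So the
  measures converge on all characters to the values of the invariant mean, hence on all almost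
  periodic functions.
\<close>

section \<open>L2 norms and Lebesgue measure under affine maps\<close>

text \<open>Two objects of the statement are given by description operators, and nothing can be
  derived about them before existence is settled. The choice in \<open>schroedinger_group\<close>
  constrains u only if some square integrable function really has the prescribed transform, which
  asks for surjectivity of the L2 Fourier transform. Surjectivity in turn rests on Plancherel. There
  the squared norm of g is recovered as the value at 0 of its autocorrelation, a function that is
  continuous at 0 because translations are continuous in L2; a shrinking family of Gaussians picks
  out that value. Integrability of sqrt \<rho> places the initial value in the intersection of L1
  and L2, where the transform is an actual integral. Later identities are proved for the relation
  \<open>has_L2_fourier\<close>, so they hold for whichever representative the choice selects. The
  definite description in \<open>invariant_mean\<close> likewise needs uniqueness, which follows
  from shifting a character by half a period.\<close>

lemma
  fixes f :: "'a::euclidean_space \<Rightarrow> 'b::{banach, second_countable_topology}"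
  assumes c: "c \<noteq> 0"
  shows lborel_integrable_affine_iff:
      "integrable lborel (\<lambda>x. f (t + c *\<^sub>R x)) \<longleftrightarrow> integrable lborel f"
    and lborel_integral_affine:
      "(\<integral>x. f x \<partial>lborel) = \<bar>c\<bar> ^ DIM('a) *\<^sub>R (\<integral>x. f (t + c *\<^sub>R x) \<partial>lborel)"
proof -
  have 1: "integrable lborel (\<lambda>x. f (t + c *\<^sub>R x))"
    if c: "c \<noteq> 0" and f: "integrable lborel f" for c t and f :: "'a \<Rightarrow> 'b"
  proof -
    have [measurable]: "f \<in> borel_measurable borel"
      using borel_measurable_integrable[OF f] by simp
    have "integrable (density (distr lborel borel (\<lambda>x. t + c *\<^sub>R x)) (\<lambda>_. ennreal (\<bar>c\<bar> ^ DIM('a)))) f"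
      using f lborel_affine[OF c, of t] by simp
    then have "integrable lborel (\<lambda>x. \<bar>c\<bar> ^ DIM('a) *\<^sub>R f (t + c *\<^sub>R x))"
      by (simp add: integrable_density integrable_distr_eq)
    then show ?thesis
      using c integrable_scaleR_right[of "inverse (\<bar>c\<bar> ^ DIM('a))" lborel
          "\<lambda>x. \<bar>c\<bar> ^ DIM('a) *\<^sub>R f (t + c *\<^sub>R x)"] by simp
  qed
  \<comment> \<open>The converse is the implication just proved, applied to the inverse map x -> (x
    - t) / c.\<close>
  show iff: "integrable lborel (\<lambda>x. f (t + c *\<^sub>R x)) \<longleftrightarrow> integrable lborel f"
    using 1[OF c, of f t] 1[of "1 / c" "\<lambda>x. f (t + c *\<^sub>R x)" "- (1 / c) *\<^sub>R t"] c
    by (auto simp: scaleR_add_right scaleR_diff_right)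
  show "(\<integral>x. f x \<partial>lborel) = \<bar>c\<bar> ^ DIM('a) *\<^sub>R (\<integral>x. f (t + c *\<^sub>R x) \<partial>lborel)"
  proof (cases "integrable lborel f")
    case True
    have [measurable]: "f \<in> borel_measurable borel"
      using borel_measurable_integrable[OF True] by simp
    have "(\<integral>x. f x \<partial>lborel) =
        (\<integral>x. f x \<partial>density (distr lborel borel (\<lambda>x. t + c *\<^sub>R x)) (\<lambda>_. ennreal (\<bar>c\<bar> ^ DIM('a))))"
      using lborel_affine[OF c, of t] by simp
    then show ?thesis
      by (simp add: integral_density integral_distr)
  \<comment> \<open>A Bochner integral of a non-integrable function is 0 by default, so here both
    sides vanish.\<close>
  qed (use iff in \<open>simp add: not_integrable_integral_eq\<close>)
qed

lemma
  fixes f :: "'a::euclidean_space \<Rightarrow> 'b::{banach, second_countable_topology}"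
  shows lborel_integrable_translate_iff: "integrable lborel (\<lambda>x. f (x + z)) \<longleftrightarrow> integrable lborel f"
    and lborel_integral_translate: "(\<integral>x. f (x + z) \<partial>lborel) = (\<integral>x. f x \<partial>lborel)"
  using lborel_integrable_affine_iff[of 1 f z] lborel_integral_affine[of 1 f z]
  by (simp_all add: add.commute)

lemma
  fixes f :: "'a::euclidean_space \<Rightarrow> 'b::{banach, second_countable_topology}"
  shows lborel_integrable_reflect_iff: "integrable lborel (\<lambda>x. f (- x)) \<longleftrightarrow> integrable lborel f"
    and lborel_integral_reflect: "(\<integral>x. f (- x) \<partial>lborel) = (\<integral>x. f x \<partial>lborel)"
  using lborel_integrable_affine_iff[of "-1" f 0] lborel_integral_affine[of "-1" f 0]
  by simp_all

text \<open>Real-valued companion of \<open>L2_sqnorm\<close>, convenient for subtraction and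
  limits. Where the squared modulus is not integrable the value defaults to 0, so the triangle
  inequalities carry square integrability hypotheses, while scaling and invariance identities hold
  outright.\<close>

definition L2_norm :: "('a::euclidean_space \<Rightarrow> complex) \<Rightarrow> real" where
  "L2_norm g = sqrt (\<integral>x. (cmod (g x))\<^sup>2 \<partial>lborel)"

lemma square_integrable_iff:
  "square_integrable g \<longleftrightarrow>
     g \<in> borel_measurable borel \<and> integrable lborel (\<lambda>x. (cmod (g x))\<^sup>2)"
  unfolding square_integrable_def L2_sqnorm_def integrable_iff_bounded
  by auto

lemma square_integrable_measurable: "square_integrable g \<Longrightarrow> g \<in> borel_measurable borel"
  and square_integrable_integrable: "square_integrable g \<Longrightarrow> integrable lborel (\<lambda>x. (cmod (g x))\<^sup>2)"
  by (simp_all add: square_integrable_iff)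

lemma L2_sqnorm_eq:
  assumes "square_integrable g"
  shows "L2_sqnorm g = ennreal ((L2_norm g)\<^sup>2)"
  using square_integrable_integrable[OF assms]
  unfolding L2_sqnorm_def L2_norm_def by (simp add: nn_integral_eq_integral)

lemma L2_norm_nonneg [simp]: "0 \<le> L2_norm g"
  by (simp add: L2_norm_def)

lemma L2_norm_power2: "(L2_norm g)\<^sup>2 = (\<integral>x. (cmod (g x))\<^sup>2 \<partial>lborel)"
  by (simp add: L2_norm_def)

lemma square_integrable_cmult:
  "square_integrable g \<Longrightarrow> square_integrable (\<lambda>x. c * g x)"
  by (auto simp: square_integrable_iff norm_mult power_mult_distrib)

lemma L2_norm_cmult: "L2_norm (\<lambda>x. c * g x) = cmod c * L2_norm g"
  by (simp add: L2_norm_def norm_mult power_mult_distrib real_sqrt_mult)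

lemma square_integrable_unimodular:
  assumes "square_integrable g" "m \<in> borel_measurable borel" "\<And>x. cmod (m x) = 1"
  shows "square_integrable (\<lambda>x. m x * g x)"
  using assms by (auto simp: square_integrable_iff norm_mult)

lemma L2_norm_unimodular:
  assumes "\<And>x. cmod (m x) = 1"
  shows "L2_norm (\<lambda>x. m x * g x) = L2_norm g"
  using assms by (simp add: L2_norm_def norm_mult)

lemma square_integrable_add:
  assumes f: "square_integrable f" and g: "square_integrable g"
  shows "square_integrable (\<lambda>x. f x + g x)"
proof -
  note [measurable] = square_integrable_measurable[OF f] square_integrable_measurable[OF g]
  have "integrable lborel (\<lambda>x. (cmod (f x + g x))\<^sup>2)"
  proof (rule Bochner_Integration.integrable_bound)
    show "integrable lborel (\<lambda>x. 2 * (cmod (f x))\<^sup>2 + 2 * (cmod (g x))\<^sup>2)"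
      using f g by (auto simp: square_integrable_iff)
    have "(cmod (f x + g x))\<^sup>2 \<le> 2 * (cmod (f x))\<^sup>2 + 2 * (cmod (g x))\<^sup>2" for x
    proof -
      have "(cmod (f x + g x))\<^sup>2 \<le> (cmod (f x) + cmod (g x))\<^sup>2"
        by (intro power_mono norm_triangle_ineq) auto
      also have "\<dots> \<le> 2 * (cmod (f x))\<^sup>2 + 2 * (cmod (g x))\<^sup>2"
        using sum_squares_bound[of "cmod (f x)" "cmod (g x)"] by (simp add: power2_sum)
      finally show ?thesis .
    qed
    then show "AE x in lborel. norm ((cmod (f x + g x))\<^sup>2)
        \<le> norm (2 * (cmod (f x))\<^sup>2 + 2 * (cmod (g x))\<^sup>2)"
      by simp
  qed simp
  then show ?thesis
    by (simp add: square_integrable_iff)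
qed

lemma square_integrable_diff:
  assumes "square_integrable f" "square_integrable g"
  shows "square_integrable (\<lambda>x. f x - g x)"
  using square_integrable_add[OF assms(1) square_integrable_cmult[OF assms(2), of "-1"]] by simp

lemma square_integrable_cnj:
  "square_integrable g \<Longrightarrow> square_integrable (\<lambda>x. cnj (g x))"
  using measurable_compose[OF _ borel_measurable_continuous_onI[of cnj], of g borel]
  by (auto simp: square_integrable_iff continuous_intros)

lemma L2_norm_minus_commute: "L2_norm (\<lambda>x. f x - g x) = L2_norm (\<lambda>x. g x - f x)"
  by (simp add: L2_norm_def norm_minus_commute)

lemma
  assumes f: "square_integrable f" and g: "square_integrable g"
  shows integrable_cmod_mult_L2: "integrable lborel (\<lambda>x. cmod (f x) * cmod (g x))"
    and integral_cmod_mult_L2_le: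
      "(\<integral>x. cmod (f x) * cmod (g x) \<partial>lborel) \<le> L2_norm f * L2_norm g"
proof -
  note [measurable] = square_integrable_measurable[OF f] square_integrable_measurable[OF g]
  show int: "integrable lborel (\<lambda>x. cmod (f x) * cmod (g x))"
  proof (rule Bochner_Integration.integrable_bound)
    show "integrable lborel (\<lambda>x. (cmod (f x))\<^sup>2 + (cmod (g x))\<^sup>2)"
      using f g by (auto simp: square_integrable_iff)
    have "cmod (f x) * cmod (g x) \<le> (cmod (f x))\<^sup>2 + (cmod (g x))\<^sup>2" for x
    proof -
      have "0 \<le> cmod (f x) * cmod (g x)" by simp
      then show ?thesis
        using sum_squares_bound[of "cmod (f x)" "cmod (g x)"] by linarith
    qed
    then show "AE x in lborel. norm (cmod (f x) * cmod (g x))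
        \<le> norm ((cmod (f x))\<^sup>2 + (cmod (g x))\<^sup>2)"
      by simp
  qed simp
  \<comment> \<open>Cauchy-Schwarz is applied to extended nonnegative integrals and then brought
    back to the reals: the left side is finite by \<open>int\<close>, the right side by square
    integrability.\<close>
  have "ennreal ((\<integral>x. cmod (f x) * cmod (g x) \<partial>lborel)\<^sup>2) =
      (\<integral>\<^sup>+x. ennreal (cmod (f x)) * ennreal (cmod (g x)) \<partial>lborel)\<^sup>2"
    using int by (simp add: nn_integral_eq_integral flip: ennreal_mult ennreal_power)
  also have "\<dots> \<le> (\<integral>\<^sup>+x. (ennreal (cmod (f x)))\<^sup>2 \<partial>lborel) * (\<integral>\<^sup>+x. (ennreal (cmod (g x)))\<^sup>2 \<partial>lborel)"
    by (rule Cauchy_Schwarz_nn_integral) auto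
  also have "\<dots> = L2_sqnorm f * L2_sqnorm g"
    by (simp add: L2_sqnorm_def ennreal_power)
  also have "\<dots> = ennreal ((L2_norm f * L2_norm g)\<^sup>2)"
    using f g by (simp add: L2_sqnorm_eq power_mult_distrib ennreal_mult)
  finally show "(\<integral>x. cmod (f x) * cmod (g x) \<partial>lborel) \<le> L2_norm f * L2_norm g"
    by (auto simp: ennreal_le_iff intro: power2_le_imp_le)
qed

lemma integrable_mult_L2:
  assumes f: "square_integrable f" and g: "square_integrable g"
  shows "integrable lborel (\<lambda>x. f x * g x)"
proof (rule Bochner_Integration.integrable_bound[OF integrable_cmod_mult_L2[OF f g]])
  note [measurable] = square_integrable_measurable[OF f] square_integrable_measurable[OF g]
  show "(\<lambda>x. f x * g x) \<in> borel_measurable lborel" by simp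
qed (simp add: norm_mult)

lemma norm_integral_mult_L2_le:
  assumes f: "square_integrable f" and g: "square_integrable g"
  shows "cmod (\<integral>x. f x * g x \<partial>lborel) \<le> L2_norm f * L2_norm g"
proof -
  have "cmod (\<integral>x. f x * g x \<partial>lborel) \<le> (\<integral>x. cmod (f x * g x) \<partial>lborel)"
    by (rule integral_norm_bound)
  also have "\<dots> \<le> L2_norm f * L2_norm g"
    using integral_cmod_mult_L2_le[OF f g] by (simp add: norm_mult)
  finally show ?thesis .
qed

lemma L2_norm_triangle:
  assumes f: "square_integrable f" and g: "square_integrable g"
  shows "L2_norm (\<lambda>x. f x + g x) \<le> L2_norm f + L2_norm g"
proof (rule power2_le_imp_le)
  have "(L2_norm (\<lambda>x. f x + g x))\<^sup>2 \<le>
      (\<integral>x. (cmod (f x))\<^sup>2 + 2 * (cmod (f x) * cmod (g x)) + (cmod (g x))\<^sup>2 \<partial>lborel)"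
    unfolding L2_norm_power2
  proof (rule integral_mono)
    fix x
    have "(cmod (f x + g x))\<^sup>2 \<le> (cmod (f x) + cmod (g x))\<^sup>2"
      by (intro power_mono norm_triangle_ineq) auto
    then show "(cmod (f x + g x))\<^sup>2 \<le>
        (cmod (f x))\<^sup>2 + 2 * (cmod (f x) * cmod (g x)) + (cmod (g x))\<^sup>2"
      by (simp add: power2_sum)
  qed (use square_integrable_add[OF f g] f g integrable_cmod_mult_L2[OF f g]
        in \<open>auto simp: square_integrable_iff\<close>)
  also have "\<dots> = (L2_norm f)\<^sup>2 + 2 * (\<integral>x. cmod (f x) * cmod (g x) \<partial>lborel) + (L2_norm g)\<^sup>2"
    using f g integrable_cmod_mult_L2[OF f g] by (simp add: L2_norm_power2 square_integrable_iff)
  also have "\<dots> \<le> (L2_norm f + L2_norm g)\<^sup>2"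
    using integral_cmod_mult_L2_le[OF f g] by (simp add: power2_sum)
  finally show "(L2_norm (\<lambda>x. f x + g x))\<^sup>2 \<le> (L2_norm f + L2_norm g)\<^sup>2" .
qed simp

lemma L2_norm_triangle_diff:
  assumes f: "square_integrable f" and g: "square_integrable g" and h: "square_integrable h"
  shows "L2_norm (\<lambda>x. f x - h x) \<le> L2_norm (\<lambda>x. f x - g x) + L2_norm (\<lambda>x. g x - h x)"
  using L2_norm_triangle[OF square_integrable_diff[OF f g] square_integrable_diff[OF g h]] by simp

lemma L2_norm_diff_abs_le:
  assumes f: "square_integrable f" and g: "square_integrable g"
  shows "\<bar>L2_norm f - L2_norm g\<bar> \<le> L2_norm (\<lambda>x. f x - g x)"
  using L2_norm_triangle[OF square_integrable_diff[OF f g] g]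
    L2_norm_triangle[OF square_integrable_diff[OF g f] f]
  by (simp add: L2_norm_minus_commute[of g f])

text \<open>Translates the extended-valued convergence in \<open>has_L2_fourier\<close> into real
  norms, for which the triangle inequality is available.\<close>

lemma L2_sqnorm_tendsto_0_iff:
  assumes "\<And>k. square_integrable (s k)"
  shows "((\<lambda>k. L2_sqnorm (s k)) \<longlongrightarrow> 0) F \<longleftrightarrow> ((\<lambda>k. L2_norm (s k)) \<longlongrightarrow> 0) F"
proof -
  have "((\<lambda>k. L2_sqnorm (s k)) \<longlongrightarrow> 0) F \<longleftrightarrow> ((\<lambda>k. (L2_norm (s k))\<^sup>2) \<longlongrightarrow> 0) F"
    using assms tendsto_ennreal_iff[of "\<lambda>k. (L2_norm (s k))\<^sup>2" F 0] by (simp add: L2_sqnorm_eq)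
  also have "\<dots> \<longleftrightarrow> ((\<lambda>k. L2_norm (s k)) \<longlongrightarrow> 0) F"
  proof
    assume "((\<lambda>k. (L2_norm (s k))\<^sup>2) \<longlongrightarrow> 0) F"
    from tendsto_real_sqrt[OF this] show "((\<lambda>k. L2_norm (s k)) \<longlongrightarrow> 0) F" by simp
  next
    assume "((\<lambda>k. L2_norm (s k)) \<longlongrightarrow> 0) F"
    from tendsto_power[OF this, of 2] show "((\<lambda>k. (L2_norm (s k))\<^sup>2) \<longlongrightarrow> 0) F" by simp
  qed
  finally show ?thesis .
qed

lemma L2_norm_tendsto:
  assumes s: "\<And>k. square_integrable (s k)" and g: "square_integrable g"
    and lim: "((\<lambda>k. L2_norm (\<lambda>x. s k x - g x)) \<longlongrightarrow> 0) F"
  shows "((\<lambda>k. L2_norm (s k)) \<longlongrightarrow> L2_norm g) F"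
proof -
  have "((\<lambda>k. L2_norm (s k) - L2_norm g) \<longlongrightarrow> 0) F"
    by (rule Lim_null_comparison[OF _ lim]) (use L2_norm_diff_abs_le[OF s g] in simp)
  then show ?thesis
    by (simp add: LIM_zero_iff)
qed

section \<open>Continuity of translations\<close>

text \<open>Translations are isometries of L1, so passing from f to an approximant g costs at most
  twice their L1 distance, uniformly in the shift. The property is thus closed under L1 limits,
  which serves both the indicator case and the limit case of the induction below.\<close>

lemma norm_translation_integral_tendsto_approx:
  fixes f :: "'a::euclidean_space \<Rightarrow> 'b::{banach, second_countable_topology}" and z :: "nat \<Rightarrow> 'a"
  assumes f: "integrable lborel f"
    and approx: "\<And>e. 0 < e \<Longrightarrow> \<exists>g. integrable lborel g \<and> (\<integral>x. norm (f x - g x) \<partial>lborel) < e \<and>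
          (\<lambda>k. \<integral>x. norm (g (x + z k) - g x) \<partial>lborel) \<longlonglongrightarrow> 0"
  shows "(\<lambda>k. \<integral>x. norm (f (x + z k) - f x) \<partial>lborel) \<longlonglongrightarrow> 0"
proof (rule LIMSEQ_I)
  fix e :: real assume "0 < e"
  then obtain g where g: "integrable lborel g" and fg: "(\<integral>x. norm (f x - g x) \<partial>lborel) < e / 3"
    and lim: "(\<lambda>k. \<integral>x. norm (g (x + z k) - g x) \<partial>lborel) \<longlonglongrightarrow> 0"
    using approx[of "e / 3"] by auto
  have shift: "integrable lborel (\<lambda>x. h (x + w))" if "integrable lborel h" for h :: "'a \<Rightarrow> 'b" and w
    using that by (simp add: lborel_integrable_translate_iff)
  from lim \<open>0 < e\<close> obtain N where N: "\<And>k. k \<ge> N \<Longrightarrow> (\<integral>x. norm (g (x + z k) - g x) \<partial>lborel) < e / 3"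
    using LIMSEQ_D[of _ 0 "e / 3"] by fastforce
  have "norm ((\<integral>x. norm (f (x + z k) - f x) \<partial>lborel) - 0) < e" if "k \<ge> N" for k
  proof -
    have "(\<integral>x. norm (f (x + z k) - f x) \<partial>lborel) \<le>
        (\<integral>x. norm (f (x + z k) - g (x + z k)) + norm (g (x + z k) - g x) + norm (f x - g x) \<partial>lborel)"
    proof (rule integral_mono)
      fix x
      have "norm (f (x + z k) - f x) = norm ((f (x + z k) - g (x + z k)) + (g (x + z k) - g x) - (f x - g x))"
        by simp
      also have "\<dots> \<le> norm ((f (x + z k) - g (x + z k)) + (g (x + z k) - g x)) + norm (f x - g x)"
        by (rule norm_triangle_ineq4)
      also have "\<dots> \<le> norm (f (x + z k) - g (x + z k)) + norm (g (x + z k) - g x) + norm (f x - g x)"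
        by (intro add_right_mono norm_triangle_ineq)
      finally show "norm (f (x + z k) - f x) \<le>
          norm (f (x + z k) - g (x + z k)) + norm (g (x + z k) - g x) + norm (f x - g x)" .
    qed (use f g shift[OF f, of "z k"] shift[OF g, of "z k"] in simp_all)
    also have "\<dots> = (\<integral>x. norm (f (x + z k) - g (x + z k)) \<partial>lborel) +
        (\<integral>x. norm (g (x + z k) - g x) \<partial>lborel) + (\<integral>x. norm (f x - g x) \<partial>lborel)"
      using f g shift[OF f, of "z k"] shift[OF g, of "z k"] by simp
    also have "(\<integral>x. norm (f (x + z k) - g (x + z k)) \<partial>lborel) = (\<integral>x. norm (f x - g x) \<partial>lborel)"
      by (rule lborel_integral_translate)
    finally show ?thesis
      using fg N[OF that] by simp
  qed
  then show "\<exists>N. \<forall>k\<ge>N. norm ((\<integral>x. norm (f (x + z k) - f x) \<partial>lborel) - 0) < e"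
    by blast
qed

text \<open>For values 0 and 1, |p - q| = p + q - 2 p q, so only the product of the two indicators
  needs a limit. A point of an open set stays inside under small shifts, and outside U the product
  is 0 anyway. Hence boundary points, which may have positive measure, cause no trouble.\<close>

lemma norm_translation_indicator_open_tendsto:
  fixes U :: "'a::euclidean_space set" and z :: "nat \<Rightarrow> 'a"
  assumes U: "open U" "emeasure lborel U < \<infinity>" and z: "z \<longlonglongrightarrow> 0"
  shows "(\<lambda>k. \<integral>x. \<bar>indicator U (x + z k) - indicator U x :: real\<bar> \<partial>lborel) \<longlonglongrightarrow> 0"
proof -
  have [measurable]: "U \<in> sets borel"
    using U by auto
  have iU: "integrable lborel (indicator U :: 'a \<Rightarrow> real)"
    using U by (simp add: integrable_indicator_iff)
  have iUz: "integrable lborel (\<lambda>x. indicator U (x + w) :: real)" for w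
    using iU by (simp add: lborel_integrable_translate_iff)
  have iUU: "integrable lborel (\<lambda>x. indicator U (x + w) * indicator U x :: real)" for w
    by (rule Bochner_Integration.integrable_bound[OF iU]) (auto simp: indicator_def)
  have "(\<lambda>k. \<integral>x. (indicator U (x + z k) * indicator U x :: real) \<partial>lborel) \<longlonglongrightarrow> (\<integral>x. indicator U x \<partial>lborel)"
  proof (rule integral_dominated_convergence[OF _ _ iU])
    show "AE x in lborel. (\<lambda>k. indicator U (x + z k) * indicator U x :: real) \<longlonglongrightarrow> indicator U x"
    proof (rule AE_I2)
      fix x
      show "(\<lambda>k. indicator U (x + z k) * indicator U x :: real) \<longlonglongrightarrow> indicator U x"
      proof (cases "x \<in> U")
        case True
        have "(\<lambda>k. x + z k) \<longlonglongrightarrow> x"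
          using tendsto_add[OF tendsto_const z, of x] by simp
        then have "\<forall>\<^sub>F k in sequentially. x + z k \<in> U"
          using U(1) True by (rule topological_tendstoD)
        then show ?thesis
          using True by (intro tendsto_eventually) (auto elim: eventually_mono)
      qed simp
    qed
  qed (auto simp: indicator_def)
  then have "(\<lambda>k. 2 * (\<integral>x. indicator U x \<partial>lborel) -
      2 * (\<integral>x. (indicator U (x + z k) * indicator U x :: real) \<partial>lborel)) \<longlonglongrightarrow> 0"
    by (auto intro!: tendsto_eq_intros)
  moreover have "(\<integral>x. \<bar>indicator U (x + w) - indicator U x :: real\<bar> \<partial>lborel) =
      2 * (\<integral>x. indicator U x \<partial>lborel) - 2 * (\<integral>x. (indicator U (x + w) * indicator U x :: real) \<partial>lborel)" for w
  proof -
    have "(\<integral>x. \<bar>indicator U (x + w) - indicator U x :: real\<bar> \<partial>lborel) =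
        (\<integral>x. indicator U (x + w) + indicator U x - 2 * (indicator U (x + w) * indicator U x) \<partial>lborel)"
      by (rule Bochner_Integration.integral_cong) (auto simp: indicator_def)
    also have "\<dots> = (\<integral>x. indicator U (x + w) \<partial>lborel) + (\<integral>x. indicator U x \<partial>lborel) -
        2 * (\<integral>x. (indicator U (x + w) * indicator U x :: real) \<partial>lborel)"
      using iU iUz iUU by simp
    finally show ?thesis
      using lborel_integral_translate[of "indicator U :: 'a \<Rightarrow> real" w] by simp
  qed
  ultimately show ?thesis
    by simp
qed

text \<open>Outer regularity replaces a measurable set of finite measure by an open superset of
  almost the same measure; sums and dominated limits then reach every integrable function.\<close>

lemma norm_translation_integral_tendsto:
  fixes f :: "'a::euclidean_space \<Rightarrow> 'b::{banach, second_countable_topology}" and z :: "nat \<Rightarrow> 'a"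
  assumes f: "integrable lborel f" and z: "z \<longlonglongrightarrow> 0"
  shows "(\<lambda>k. \<integral>x. norm (f (x + z k) - f x) \<partial>lborel) \<longlonglongrightarrow> 0"
  using f
proof (induction rule: integrable_induct)
  case (base A c)
  have [measurable]: "A \<in> sets borel" using base by simp
  have iA: "integrable lborel (\<lambda>x. indicator A x *\<^sub>R c)"
    using base by (intro integrable_scaleR_left) (simp add: integrable_indicator_iff)
  show ?case
  proof (rule norm_translation_integral_tendsto_approx[OF iA])
    fix e :: real assume "0 < e"
    \<comment> \<open>Adding 1 keeps the quotient meaningful for c = 0 and makes
      \<open>d * norm c\<close> strictly smaller than e.\<close>
    define d where "d = e / (norm c + 1)"
    have d: "0 < d" "d * norm c < e"
      using \<open>0 < e\<close> by (auto simp: d_def field_simps add_pos_nonneg intro: add_pos_nonneg)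
    obtain U where U: "open U" "A \<subseteq> U" "emeasure lborel (U - A) < d"
      using outer_regular_lborel[of A d] base d by auto
    have [measurable]: "U \<in> sets borel" using U by auto
    have "U = A \<union> (U - A)" using U by auto
    then have "emeasure lborel U \<le> emeasure lborel A + emeasure lborel (U - A)"
      by (metis emeasure_subadditive sets.Diff sets_lborel \<open>A \<in> sets borel\<close> \<open>U \<in> sets borel\<close>)
    also have "\<dots> < \<infinity>"
      using base U(3) by (auto simp: top_unique less_top dest: less_trans[OF _ ennreal_less_top])
    finally have fU: "emeasure lborel U < \<infinity>" .
    let ?g = "\<lambda>x. indicator U x *\<^sub>R c"
    have ig: "integrable lborel ?g"
      using fU by (intro integrable_scaleR_left) (simp add: integrable_indicator_iff)
    have "(\<integral>x. norm (indicator A x *\<^sub>R c - ?g x) \<partial>lborel) = (\<integral>x. indicator (U - A) x * norm c \<partial>lborel)"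
      using U(2) by (intro Bochner_Integration.integral_cong) (auto simp: indicator_def)
    also have "\<dots> = measure lborel (U - A) * norm c"
      by simp
    also have "\<dots> \<le> d * norm c"
      using U(3) d(1) by (intro mult_right_mono) (auto simp: measure_def enn2real_leI less_imp_le)
    finally have 1: "(\<integral>x. norm (indicator A x *\<^sub>R c - ?g x) \<partial>lborel) < e"
      using d by simp
    have "(\<lambda>k. (\<integral>x. \<bar>indicator U (x + z k) - indicator U x :: real\<bar> \<partial>lborel) * norm c) \<longlonglongrightarrow> 0"
      using norm_translation_indicator_open_tendsto[OF U(1) fU z] by (auto intro: tendsto_mult_left_zero)
    then have 2: "(\<lambda>k. \<integral>x. norm (?g (x + z k) - ?g x) \<partial>lborel) \<longlonglongrightarrow> 0"
      by (simp flip: scaleR_left_diff_distrib)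
    show "\<exists>g. integrable lborel g \<and> (\<integral>x. norm (indicator A x *\<^sub>R c - g x) \<partial>lborel) < e \<and>
          (\<lambda>k. \<integral>x. norm (g (x + z k) - g x) \<partial>lborel) \<longlonglongrightarrow> 0"
      using ig 1 2 by blast
  qed
next
  case (add f g)
  have shift: "integrable lborel (\<lambda>x. h (x + w))" if "integrable lborel h" for h :: "'a \<Rightarrow> 'b" and w
    using that by (simp add: lborel_integrable_translate_iff)
  show ?case
  proof (rule Lim_null_comparison)
    show "(\<lambda>k. (\<integral>x. norm (f (x + z k) - f x) \<partial>lborel) + (\<integral>x. norm (g (x + z k) - g x) \<partial>lborel)) \<longlonglongrightarrow> 0"
      using add tendsto_add_zero by blast
    have "(\<integral>x. norm (f (x + w) + g (x + w) - (f x + g x)) \<partial>lborel) \<le>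
        (\<integral>x. norm (f (x + w) - f x) + norm (g (x + w) - g x) \<partial>lborel)" for w
    proof (rule integral_mono)
      fix x
      show "norm (f (x + w) + g (x + w) - (f x + g x)) \<le> norm (f (x + w) - f x) + norm (g (x + w) - g x)"
        using norm_triangle_ineq[of "f (x + w) - f x" "g (x + w) - g x"] by (simp add: algebra_simps)
    qed (use add shift[OF add(1), of w] shift[OF add(2), of w] in simp_all)
    then show "\<forall>\<^sub>F k in sequentially. norm (\<integral>x. norm (f (x + z k) + g (x + z k) - (f x + g x)) \<partial>lborel) \<le>
        (\<integral>x. norm (f (x + z k) - f x) \<partial>lborel) + (\<integral>x. norm (g (x + z k) - g x) \<partial>lborel)"
      using shift[OF add(1)] shift[OF add(2)] add(1,2) by simp
  qed
next
  case (lim f s)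
  show ?case
  proof (rule norm_translation_integral_tendsto_approx[OF lim(4)])
    fix e :: real assume "0 < e"
    note [measurable] = borel_measurable_integrable[OF lim(1)] borel_measurable_integrable[OF lim(4)]
    have "(\<lambda>i. \<integral>x. norm (f x - s i x) \<partial>lborel) \<longlonglongrightarrow> (\<integral>(x::'a). 0 \<partial>lborel)"
    proof (rule integral_dominated_convergence)
      \<comment> \<open>The induction supplies \<open>norm (s i x) \<le> 2 * norm (f x)\<close>,
        hence the dominating factor 3 = 1 + 2.\<close>
      show "integrable lborel (\<lambda>x. 3 * norm (f x))"
        using lim(4) by auto
      show "AE x in lborel. (\<lambda>i. norm (f x - s i x)) \<longlonglongrightarrow> 0"
        using lim(2) by (intro AE_I2) (auto intro!: tendsto_eq_intros)
      show "AE x in lborel. norm (norm (f x - s i x)) \<le> 3 * norm (f x)" for i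
      proof (rule AE_I2)
        fix x
        show "norm (norm (f x - s i x)) \<le> 3 * norm (f x)"
          using norm_triangle_ineq4[of "f x" "s i x"] lim(3)[of x i] by simp
      qed
    qed auto
    then have "\<forall>\<^sub>F i in sequentially. (\<integral>x. norm (f x - s i x) \<partial>lborel) < e"
      using \<open>0 < e\<close> by (simp add: order_tendstoD)
    then obtain i where "(\<integral>x. norm (f x - s i x) \<partial>lborel) < e"
      by (auto simp: eventually_sequentially)
    then show "\<exists>g. integrable lborel g \<and> (\<integral>x. norm (f x - g x) \<partial>lborel) < e \<and>
          (\<lambda>k. \<integral>x. norm (g (x + z k) - g x) \<partial>lborel) \<longlonglongrightarrow> 0"
      using lim(1,5) by blast
  qed
qed

text \<open>The map \<open>a \<mapsto> |a| a\<close> sends \<open>L\<^sup>2\<close> to \<open>L\<^sup>1\<close>, so this reduces continuity of translations in \<open>L\<^sup>2\<close> to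
  that in \<open>L\<^sup>1\<close>.\<close>

lemma norm_diff_power2_le:
  fixes a b :: "'a::real_inner"
  shows "(norm (a - b))\<^sup>2 \<le> 2 * norm (norm a *\<^sub>R a - norm b *\<^sub>R b)"
proof -
  let ?s = "norm a + norm b"
  have ab: "a \<bullet> b = ((norm a)\<^sup>2 + (norm b)\<^sup>2 - (norm (a - b))\<^sup>2) / 2"
    by (simp add: power2_norm_eq_inner inner_diff_left inner_diff_right inner_commute)
  \<comment> \<open>The pairing with a - b equals ?s / 2 * |a - b|^2 plus the nonnegative term ?s /
    2 * (|a| - |b|)^2. Cauchy-Schwarz bounds it from above, |a - b| \<le> ?s bounds it from below,
    and one factor |a - b| cancels.\<close>
  have "(norm a *\<^sub>R a - norm b *\<^sub>R b) \<bullet> (a - b) = norm a ^ 3 + norm b ^ 3 - ?s * (a \<bullet> b)"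
    by (simp add: inner_diff_left inner_diff_right inner_commute[of b a] dot_square_norm
        power2_eq_square power3_eq_cube algebra_simps)
  then have "(norm a *\<^sub>R a - norm b *\<^sub>R b) \<bullet> (a - b) =
      ?s / 2 * (norm (a - b))\<^sup>2 + ?s / 2 * (norm a - norm b)\<^sup>2"
    unfolding ab by (simp add: power2_eq_square power3_eq_cube field_simps)
  then have "?s / 2 * (norm (a - b))\<^sup>2 \<le> (norm a *\<^sub>R a - norm b *\<^sub>R b) \<bullet> (a - b)"
    by (simp add: add_nonneg_nonneg)
  also have "\<dots> \<le> norm (norm a *\<^sub>R a - norm b *\<^sub>R b) * norm (a - b)"
    by (rule norm_cauchy_schwarz)
  finally have 1: "?s / 2 * (norm (a - b))\<^sup>2 \<le> norm (norm a *\<^sub>R a - norm b *\<^sub>R b) * norm (a - b)" .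
  have "norm (a - b) / 2 * (norm (a - b))\<^sup>2 \<le> ?s / 2 * (norm (a - b))\<^sup>2"
    using norm_triangle_ineq4[of a b] by (intro mult_right_mono) auto
  with 1 have "norm (a - b) * ((norm (a - b))\<^sup>2 / 2) \<le> norm (a - b) * norm (norm a *\<^sub>R a - norm b *\<^sub>R b)"
    by (simp add: mult.commute)
  then show ?thesis
    by (cases "a = b") auto
qed

lemma
  assumes g: "square_integrable g"
  shows square_integrable_translate: "square_integrable (\<lambda>x. g (x + w))"
    and square_integrable_reflect: "square_integrable (\<lambda>x. g (- x))"
proof -
  note [measurable] = square_integrable_measurable[OF g]
  show "square_integrable (\<lambda>x. g (x + w))" "square_integrable (\<lambda>x. g (- x))"
    using g lborel_integrable_translate_iff[of "\<lambda>x. (cmod (g x))\<^sup>2" w]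
      lborel_integrable_reflect_iff[of "\<lambda>x. (cmod (g x))\<^sup>2"]
    by (auto simp: square_integrable_iff)
qed

lemma
  shows L2_norm_translate: "L2_norm (\<lambda>x. g (x + w)) = L2_norm g"
    and L2_norm_reflect: "L2_norm (\<lambda>x. g (- x)) = L2_norm g"
  using lborel_integral_translate[of "\<lambda>x. (cmod (g x))\<^sup>2" w]
    lborel_integral_reflect[of "\<lambda>x. (cmod (g x))\<^sup>2"]
  by (simp_all add: L2_norm_def)

lemma L2_norm_translation_tendsto:
  fixes g :: "'a::euclidean_space \<Rightarrow> complex" and z :: "nat \<Rightarrow> 'a"
  assumes g: "square_integrable g" and z: "z \<longlonglongrightarrow> 0"
  shows "(\<lambda>k. L2_norm (\<lambda>x. g (x + z k) - g x)) \<longlonglongrightarrow> 0"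
proof -
  let ?f = "\<lambda>x. cmod (g x) *\<^sub>R g x"
  note [measurable] = square_integrable_measurable[OF g]
  have "integrable lborel ?f"
    by (rule Bochner_Integration.integrable_bound[OF square_integrable_integrable[OF g]])
      (auto simp: power2_eq_square norm_mult)
  from norm_translation_integral_tendsto[OF this z]
  have 0: "(\<lambda>k. 2 * (\<integral>x. cmod (?f (x + z k) - ?f x) \<partial>lborel)) \<longlonglongrightarrow> 0"
    by (rule tendsto_mult_right_zero)
  have int: "integrable lborel (\<lambda>x. cmod (?f (x + w) - ?f x))" for w
    using \<open>integrable lborel ?f\<close> lborel_integrable_translate_iff[of ?f w] by auto
  have "(L2_norm (\<lambda>x. g (x + w) - g x))\<^sup>2 \<le> 2 * (\<integral>x. cmod (?f (x + w) - ?f x) \<partial>lborel)" for w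
  proof -
    have "(L2_norm (\<lambda>x. g (x + w) - g x))\<^sup>2 \<le> (\<integral>x. 2 * cmod (?f (x + w) - ?f x) \<partial>lborel)"
      unfolding L2_norm_power2
      by (rule integral_mono)
        (use int square_integrable_diff[OF square_integrable_translate[OF g] g] norm_diff_power2_le[of "g _" "g _"]
          in \<open>auto simp: square_integrable_iff\<close>)
    then show ?thesis
      using int by simp
  qed
  then have "(\<lambda>k. (L2_norm (\<lambda>x. g (x + z k) - g x))\<^sup>2) \<longlonglongrightarrow> 0"
    by (intro Lim_null_comparison[OF _ 0]) simp
  from tendsto_real_sqrt[OF this] show ?thesis
    by simp
qed

section \<open>The Fourier transform on integrable functions\<close>

text \<open>By \<open>lborel_eq\<close> Lebesgue measure is the image of a product over the
  coordinates, so integrands that split along \<open>Basis\<close> reduce to dimension one. This is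
  how the Gaussian is treated.\<close>

lemma
  fixes f :: "'a::euclidean_space \<Rightarrow> real \<Rightarrow> 'b::{real_normed_field,banach,second_countable_topology}"
  assumes f: "\<And>b. b \<in> Basis \<Longrightarrow> integrable lborel (f b)"
  shows lborel_integrable_prod_Basis: "integrable lborel (\<lambda>x. \<Prod>b\<in>Basis. f b (x \<bullet> b))"
    and lborel_integral_prod_Basis:
      "(\<integral>x. (\<Prod>b\<in>Basis. f b (x \<bullet> b)) \<partial>lborel) = (\<Prod>b\<in>Basis. \<integral>x. f b x \<partial>lborel)"
proof -
  interpret product_sigma_finite "\<lambda>_::'a. lborel :: real measure" ..
  have [measurable]: "f b \<in> borel_measurable borel" if "b \<in> Basis" for b
    using borel_measurable_integrable[OF f[OF that]] by simp
  have "(\<Prod>b\<in>Basis. f b ((\<Sum>c\<in>Basis. y c *\<^sub>R c) \<bullet> b)) = (\<Prod>b\<in>Basis. f b (y b))" for y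
    by (intro prod.cong) simp_all
  moreover have [measurable]: "(\<lambda>x. \<Prod>b\<in>Basis. f b (x \<bullet> b)) \<in> borel_measurable borel"
    by measurable
  ultimately show "integrable lborel (\<lambda>x. \<Prod>b\<in>Basis. f b (x \<bullet> b))"
    and "(\<integral>x. (\<Prod>b\<in>Basis. f b (x \<bullet> b)) \<partial>lborel) = (\<Prod>b\<in>Basis. \<integral>x. f b x \<partial>lborel)"
    using f
    by (subst lborel_eq, simp add: integrable_distr_eq integral_distr product_integrable_prod
        product_integral_prod)+
qed

section \<open>The Gaussian and its Fourier transform\<close>

lemma
  shows integrable_exp_neg_half_square: "integrable lborel (\<lambda>x::real. exp (- x\<^sup>2 / 2))"
    and integral_iexp_exp_neg_half_square:
      "(\<integral>x. exp (- \<i> * complex_of_real (x * s)) * complex_of_real (exp (- x\<^sup>2 / 2)) \<partial>lborel) =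
        complex_of_real (sqrt (2 * pi) * exp (- s\<^sup>2 / 2))"
proof -
  have "integrable lborel (\<lambda>x. sqrt (2 * pi) * std_normal_density x)"
    by simp
  then show "integrable lborel (\<lambda>x::real. exp (- x\<^sup>2 / 2))"
    by (simp add: std_normal_density_def)
  \<comment> \<open>The transform in dimension one is the characteristic function of the standard
    normal law; the minus sign in the Fourier exponent turns its argument into -s.\<close>
  have "complex_of_real (exp (- s\<^sup>2 / 2)) = char std_normal_distribution (- s)"
    by (simp add: char_std_normal_distribution)
  also have "\<dots> = (\<integral>x. std_normal_density x *\<^sub>R exp (\<i> * complex_of_real (- s * x)) \<partial>lborel)"
    unfolding char_def by (subst integral_density) auto
  also have "\<dots> = (\<integral>x. complex_of_real (1 / sqrt (2 * pi)) *
      (exp (- \<i> * complex_of_real (x * s)) * complex_of_real (exp (- x\<^sup>2 / 2))) \<partial>lborel)"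
    by (intro Bochner_Integration.integral_cong)
      (auto simp: std_normal_density_def scaleR_conv_of_real mult_ac)
  also have "\<dots> = complex_of_real (1 / sqrt (2 * pi)) *
      (\<integral>x. exp (- \<i> * complex_of_real (x * s)) * complex_of_real (exp (- x\<^sup>2 / 2)) \<partial>lborel)"
    by simp
  finally show "(\<integral>x. exp (- \<i> * complex_of_real (x * s)) * complex_of_real (exp (- x\<^sup>2 / 2)) \<partial>lborel) =
        complex_of_real (sqrt (2 * pi) * exp (- s\<^sup>2 / 2))"
    by (simp add: field_simps)
qed

lemma exp_neg_half_norm_eq_prod:
  "exp (- (norm x)\<^sup>2 / 2) = (\<Prod>b\<in>Basis. exp (- (x \<bullet> b)\<^sup>2 / 2))" for x :: "'a::euclidean_space"
  by (simp add: exp_sum[symmetric] norm_eq_sqrt_inner euclidean_inner[of x x] power2_eq_square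
      sum_negf sum_divide_distrib sum_nonneg)

lemma integrable_gaussian:
  "integrable lborel (\<lambda>x::'a::euclidean_space. exp (- (norm x)\<^sup>2 / 2))"
  unfolding exp_neg_half_norm_eq_prod
  by (rule lborel_integrable_prod_Basis[of "\<lambda>_ x. exp (- x\<^sup>2 / 2)"]) (rule integrable_exp_neg_half_square)

lemma fourier_gaussian:
  "fourier (\<lambda>x. complex_of_real (exp (- (norm x)\<^sup>2 / 2))) \<xi> =
     complex_of_real (sqrt (2 * pi) ^ DIM('a) * exp (- (norm \<xi>)\<^sup>2 / 2))"
  for \<xi> :: "'a::euclidean_space"
proof -
  let ?f = "\<lambda>b x. exp (- \<i> * complex_of_real (x * (\<xi> \<bullet> b))) * complex_of_real (exp (- x\<^sup>2 / 2))"
  have int: "integrable lborel (?f b)" for b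
    by (rule Bochner_Integration.integrable_bound[OF integrable_exp_neg_half_square])
      (auto simp: norm_mult)
  have "exp (- \<i> * complex_of_real (x \<bullet> \<xi>)) = (\<Prod>b\<in>Basis. exp (- \<i> * complex_of_real ((x \<bullet> b) * (\<xi> \<bullet> b))))"
    for x
    by (simp add: exp_sum[symmetric] euclidean_inner[of x \<xi>] sum_distrib_left sum_negf)
  then have "fourier (\<lambda>x. complex_of_real (exp (- (norm x)\<^sup>2 / 2))) \<xi> =
      (\<integral>x. (\<Prod>b\<in>Basis. ?f b (x \<bullet> b)) \<partial>lborel)"
    unfolding fourier_def exp_neg_half_norm_eq_prod by (simp add: prod.distrib)
  also have "\<dots> = (\<Prod>b\<in>Basis. \<integral>x. ?f b x \<partial>lborel)"
    by (rule lborel_integral_prod_Basis) (rule int)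
  also have "\<dots> = complex_of_real (sqrt (2 * pi) ^ DIM('a) * (\<Prod>b\<in>Basis. exp (- (\<xi> \<bullet> b)\<^sup>2 / 2)))"
    by (simp only: integral_iexp_exp_neg_half_square) (simp add: prod.distrib)
  finally show ?thesis
    by (simp only: exp_neg_half_norm_eq_prod)
qed

section \<open>Calculus of the Fourier integral\<close>

lemma fourier_measurable [measurable]:
  assumes [measurable]: "f \<in> borel_measurable borel"
  shows "fourier f \<in> borel_measurable borel"
  unfolding fourier_def[abs_def] by measurable

lemma norm_iexp [simp]: "cmod (exp (- (\<i> * complex_of_real r))) = 1" "cmod (exp (\<i> * complex_of_real r)) = 1"
  by (simp_all add: norm_exp_eq_Re)

lemma norm_fourier_le: "cmod (fourier f \<xi>) \<le> (\<integral>x. cmod (f x) \<partial>lborel)"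
proof -
  have "cmod (fourier f \<xi>) \<le> (\<integral>x. cmod (exp (- \<i> * complex_of_real (x \<bullet> \<xi>)) * f x) \<partial>lborel)"
    unfolding fourier_def by (rule integral_norm_bound)
  then show ?thesis
    by (simp add: norm_mult)
qed

lemma integrable_iexp_mult:
  assumes "integrable lborel f"
  shows "integrable lborel (\<lambda>x. exp (- \<i> * complex_of_real (x \<bullet> \<xi>)) * f x)"
proof -
  have [measurable]: "f \<in> borel_measurable borel"
    using borel_measurable_integrable[OF assms] by simp
  show ?thesis
    by (rule Bochner_Integration.integrable_bound[OF assms]) (auto simp: norm_mult)
qed

text \<open>Both sides are the same double integral because the kernel is symmetric in x and \<xi>;
  its modulus is |f(x)| |g(\<xi>)|, so Fubini applies. The formula is used with a Gaussian to prove
  Plancherel, and with a conjugated factor to express the adjoint of the transform.\<close>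

lemma fourier_multiplication:
  fixes f g :: "'a::euclidean_space \<Rightarrow> complex"
  assumes f: "integrable lborel f" and g: "integrable lborel g"
  shows "(\<integral>\<xi>. fourier f \<xi> * g \<xi> \<partial>lborel) = (\<integral>x. f x * fourier g x \<partial>lborel)"
proof -
  have [measurable]: "f \<in> borel_measurable borel" "g \<in> borel_measurable borel"
    using borel_measurable_integrable[OF f] borel_measurable_integrable[OF g] by simp_all
  let ?F = "\<lambda>x \<xi>. exp (- \<i> * complex_of_real (x \<bullet> \<xi>)) * f x * g \<xi>"
  have "integrable (lborel \<Otimes>\<^sub>M lborel) (case_prod ?F)"
  proof (rule lborel_pair.Fubini_integrable)
    show "integrable lborel (\<lambda>x. \<integral>\<xi>. norm (case (x, \<xi>) of (x, \<xi>) \<Rightarrow> ?F x \<xi>) \<partial>lborel)"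
      using f by (simp add: norm_mult)
    show "AE x in lborel. integrable lborel (\<lambda>\<xi>. case (x, \<xi>) of (x, \<xi>) \<Rightarrow> ?F x \<xi>)"
    proof (rule AE_I2)
      fix x
      have "integrable lborel (\<lambda>\<xi>. exp (- \<i> * complex_of_real (\<xi> \<bullet> x)) * (f x * g \<xi>))"
        by (rule integrable_iexp_mult) (use g in simp)
      then show "integrable lborel (\<lambda>\<xi>. case (x, \<xi>) of (x, \<xi>) \<Rightarrow> ?F x \<xi>)"
        by (simp add: mult.assoc inner_commute)
    qed
  qed (simp add: case_prod_unfold)
  from lborel_pair.Fubini_integral[OF this]
  have "(\<integral>\<xi>. (\<integral>x. ?F x \<xi> \<partial>lborel) \<partial>lborel) = (\<integral>x. (\<integral>\<xi>. ?F x \<xi> \<partial>lborel) \<partial>lborel)" .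
  moreover have "(\<integral>x. ?F x \<xi> \<partial>lborel) = fourier f \<xi> * g \<xi>" for \<xi>
    by (simp add: fourier_def)
  moreover have "(\<integral>\<xi>. ?F x \<xi> \<partial>lborel) = f x * fourier g x" for x
  proof -
    have "(\<integral>\<xi>. ?F x \<xi> \<partial>lborel) = (\<integral>\<xi>. f x * (exp (- \<i> * complex_of_real (\<xi> \<bullet> x)) * g \<xi>) \<partial>lborel)"
      by (simp add: mult_ac inner_commute)
    then show ?thesis
      by (simp add: fourier_def)
  qed
  ultimately show ?thesis
    by (simp only:)
qed

lemma fourier_translate:
  "fourier (\<lambda>x. f (x + b)) \<xi> = exp (\<i> * complex_of_real (b \<bullet> \<xi>)) * fourier f \<xi>"
proof -
  have "fourier (\<lambda>x. f (x + b)) \<xi> =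
      (\<integral>x. exp (- \<i> * complex_of_real ((x + b - b) \<bullet> \<xi>)) * f (x + b) \<partial>lborel)"
    by (simp add: fourier_def)
  also have "\<dots> = (\<integral>x. exp (- \<i> * complex_of_real ((x - b) \<bullet> \<xi>)) * f x \<partial>lborel)"
    by (rule lborel_integral_translate)
  also have "\<dots> = (\<integral>x. exp (\<i> * complex_of_real (b \<bullet> \<xi>)) *
      (exp (- \<i> * complex_of_real (x \<bullet> \<xi>)) * f x) \<partial>lborel)"
    by (intro Bochner_Integration.integral_cong)
      (auto simp: inner_diff_left algebra_simps simp flip: exp_add)
  finally show ?thesis
    by (simp add: fourier_def)
qed

lemma fourier_modulate:
  "fourier (\<lambda>x. exp (\<i> * complex_of_real (x \<bullet> \<eta>)) * f x) \<xi> = fourier f (\<xi> - \<eta>)"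
  unfolding fourier_def
  by (intro Bochner_Integration.integral_cong)
    (auto simp: inner_diff_right algebra_simps simp flip: exp_add)

text \<open>The result is a Gaussian of total mass (2 pi)^n that concentrates at 0 as d tends to 0.
  It acts as an approximate identity, and its mass is the constant in Plancherel's theorem.\<close>

lemma fourier_scaled_gaussian:
  fixes z :: "'a::euclidean_space"
  assumes d: "0 < d"
  shows "fourier (\<lambda>x. complex_of_real (exp (- (norm (d *\<^sub>R x))\<^sup>2 / 2))) z =
     complex_of_real (sqrt (2 * pi) ^ DIM('a) / d ^ DIM('a) * exp (- (norm (z /\<^sub>R d))\<^sup>2 / 2))"
proof -
  have "complex_of_real (sqrt (2 * pi) ^ DIM('a) * exp (- (norm (z /\<^sub>R d))\<^sup>2 / 2)) =
      (\<integral>x. exp (- \<i> * complex_of_real (x \<bullet> (z /\<^sub>R d))) * complex_of_real (exp (- (norm x)\<^sup>2 / 2)) \<partial>lborel)"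
    using fourier_gaussian[of "z /\<^sub>R d"] by (simp add: fourier_def)
  also have "\<dots> = \<bar>d\<bar> ^ DIM('a) *\<^sub>R (\<integral>x. exp (- \<i> * complex_of_real ((0 + d *\<^sub>R x) \<bullet> (z /\<^sub>R d))) *
      complex_of_real (exp (- (norm (0 + d *\<^sub>R x))\<^sup>2 / 2)) \<partial>lborel)"
    using d by (intro lborel_integral_affine) auto
  also have "\<dots> = complex_of_real (d ^ DIM('a)) *
      fourier (\<lambda>x. complex_of_real (exp (- (norm (d *\<^sub>R x))\<^sup>2 / 2))) z"
  proof -
    have "(0 + d *\<^sub>R x) \<bullet> (z /\<^sub>R d) = x \<bullet> z" for x
      using d by simp
    then show ?thesis
      using d by (simp only: fourier_def scaleR_conv_of_real) simp
  qed
  finally show ?thesis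
    using d by (simp add: field_simps)
qed

section \<open>Plancherel on integrable square integrable functions\<close>

text \<open>The convolution of g with the conjugate of its reflection. Its value at 0 is the squared
  L2 norm and its transform is the squared modulus of \<open>fourier g\<close>, so Plancherel
  becomes Fourier inversion at the single point 0.\<close>

definition autocorrelation :: "('a::euclidean_space \<Rightarrow> complex) \<Rightarrow> 'a \<Rightarrow> complex" where
  "autocorrelation g z = (\<integral>y. g (y + z) * cnj (g y) \<partial>lborel)"

lemma borel_measurable_cnj [measurable]:
  assumes "f \<in> borel_measurable M"
  shows "(\<lambda>x. cnj (f x)) \<in> borel_measurable M"
  by (rule measurable_compose[OF assms borel_measurable_continuous_onI[of cnj]])
    (auto intro: continuous_intros)

lemma autocorrelation_measurable [measurable]:
  assumes [measurable]: "g \<in> borel_measurable borel"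
  shows "autocorrelation g \<in> borel_measurable borel"
  unfolding autocorrelation_def[abs_def] by measurable

lemma norm_autocorrelation_le:
  assumes "square_integrable g"
  shows "cmod (autocorrelation g z) \<le> (L2_norm g)\<^sup>2"
  using norm_integral_mult_L2_le[OF square_integrable_translate[OF assms, of z] square_integrable_cnj[OF assms]]
  by (simp add: autocorrelation_def L2_norm_translate power2_eq_square) (simp add: L2_norm_def)

lemma autocorrelation_0:
  "autocorrelation g 0 = complex_of_real ((L2_norm g)\<^sup>2)"
  unfolding autocorrelation_def L2_norm_power2
  by (simp add: complex_norm_square[symmetric] flip: integral_complex_of_real of_real_power)

text \<open>Cauchy-Schwarz bounds the increment at 0 by the L2 distance between g and its translate;
  this is where continuity of translations enters.\<close>

lemma autocorrelation_tendsto: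
  assumes g: "square_integrable g" and z: "z \<longlonglongrightarrow> 0"
  shows "(\<lambda>k. autocorrelation g (z k)) \<longlonglongrightarrow> complex_of_real ((L2_norm g)\<^sup>2)"
proof -
  have "(\<lambda>k. autocorrelation g (z k) - autocorrelation g 0) \<longlonglongrightarrow> 0"
  proof (rule Lim_null_comparison)
    show "(\<lambda>k. L2_norm (\<lambda>x. g (x + z k) - g x) * L2_norm (\<lambda>x. cnj (g x))) \<longlonglongrightarrow> 0"
      by (intro tendsto_mult_left_zero L2_norm_translation_tendsto g z)
    have "cmod (autocorrelation g w - autocorrelation g 0) \<le>
        L2_norm (\<lambda>x. g (x + w) - g x) * L2_norm (\<lambda>x. cnj (g x))" for w
    proof -
      have "autocorrelation g w - autocorrelation g 0 =
          (\<integral>x. (g (x + w) - g x) * cnj (g x) \<partial>lborel)"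
        using integrable_mult_L2[OF square_integrable_translate[OF g] square_integrable_cnj[OF g], of w]
          integrable_mult_L2[OF g square_integrable_cnj[OF g]]
        by (simp add: autocorrelation_def left_diff_distrib)
      then show ?thesis
        using norm_integral_mult_L2_le[OF square_integrable_diff[OF square_integrable_translate[OF g] g]
            square_integrable_cnj[OF g]]
        by simp
    qed
    then show "\<forall>\<^sub>F k in sequentially. norm (autocorrelation g (z k) - autocorrelation g 0) \<le>
        L2_norm (\<lambda>x. g (x + z k) - g x) * L2_norm (\<lambda>x. cnj (g x))"
      by simp
  qed
  then show ?thesis
    by (simp add: LIM_zero_iff autocorrelation_0)
qed

lemma
  assumes g: "integrable lborel g"
  shows integrable_autocorrelation: "integrable lborel (autocorrelation g)"
    and fourier_autocorrelation:
      "fourier (autocorrelation g) \<xi> = complex_of_real ((cmod (fourier g \<xi>))\<^sup>2)"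
proof -
  have [measurable]: "g \<in> borel_measurable borel"
    using borel_measurable_integrable[OF g] by simp
  have gz: "integrable lborel (\<lambda>z. g (y + z))" for y
    using g lborel_integrable_translate_iff[of g y] by (simp add: add.commute)
  have gzi: "(\<integral>z. cmod (g (y + z)) \<partial>lborel) = (\<integral>z. cmod (g z) \<partial>lborel)" for y
    using lborel_integral_translate[of "\<lambda>x. cmod (g x)" y] by (simp add: add.commute)
  have int: "integrable (lborel \<Otimes>\<^sub>M lborel)
      (\<lambda>(y, z). exp (- \<i> * complex_of_real (z \<bullet> \<xi>)) * (g (y + z) * cnj (g y)))" for \<xi>
  proof (rule lborel_pair.Fubini_integrable)
    show "integrable lborel (\<lambda>y. \<integral>z. norm (case (y, z) of (y, z) \<Rightarrow>
        exp (- \<i> * complex_of_real (z \<bullet> \<xi>)) * (g (y + z) * cnj (g y))) \<partial>lborel)"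
      using g by (simp add: norm_mult gzi)
    show "AE y in lborel. integrable lborel (\<lambda>z. case (y, z) of (y, z) \<Rightarrow>
        exp (- \<i> * complex_of_real (z \<bullet> \<xi>)) * (g (y + z) * cnj (g y)))"
    proof (rule AE_I2)
      fix y
      have "integrable lborel (\<lambda>z. exp (- \<i> * complex_of_real (z \<bullet> \<xi>)) * (g (y + z) * cnj (g y)))"
        by (rule integrable_iexp_mult) (use gz in simp)
      then show "integrable lborel (\<lambda>z. case (y, z) of (y, z) \<Rightarrow>
          exp (- \<i> * complex_of_real (z \<bullet> \<xi>)) * (g (y + z) * cnj (g y)))"
        by simp
    qed
  qed (simp add: case_prod_unfold)
  show "integrable lborel (autocorrelation g)"
    \<comment> \<open>At frequency 0 the exponential is 1, so the Fubini integrand is that of the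
      autocorrelation itself.\<close>
    using lborel_pair.integrable_snd[OF int[of 0]] by (simp add: autocorrelation_def[abs_def])
  have "fourier (autocorrelation g) \<xi> =
      (\<integral>z. (\<integral>y. exp (- \<i> * complex_of_real (z \<bullet> \<xi>)) * (g (y + z) * cnj (g y)) \<partial>lborel) \<partial>lborel)"
    unfolding fourier_def autocorrelation_def by simp
  also have "\<dots> =
      (\<integral>y. (\<integral>z. exp (- \<i> * complex_of_real (z \<bullet> \<xi>)) * (g (y + z) * cnj (g y)) \<partial>lborel) \<partial>lborel)"
    by (rule lborel_pair.Fubini_integral[OF int])
  also have "\<dots> = (\<integral>y. cnj (g y) * fourier (\<lambda>z. g (z + y)) \<xi> \<partial>lborel)"
    unfolding fourier_def
    by (subst integral_mult_right_zero[symmetric]) (simp add: mult_ac add.commute)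
  \<comment> \<open>The phase created by translating g by y joins \<open>cnj (g y)\<close> and forms
    the conjugated integrand of \<open>fourier g \<xi>\<close>.\<close>
  also have "\<dots> = (\<integral>y. fourier g \<xi> * cnj (exp (- \<i> * complex_of_real (y \<bullet> \<xi>)) * g y) \<partial>lborel)"
    by (intro Bochner_Integration.integral_cong) (auto simp: fourier_translate exp_cnj mult_ac)
  also have "\<dots> = fourier g \<xi> * cnj (fourier g \<xi>)"
    unfolding integral_mult_right_zero fourier_def
    using Bochner_Integration.integral_cnj[of lborel "\<lambda>y. exp (- \<i> * complex_of_real (y \<bullet> \<xi>)) * g y"] by (simp only:)
  finally show "fourier (autocorrelation g) \<xi> = complex_of_real ((cmod (fourier g \<xi>))\<^sup>2)"
    by (simp add: complex_norm_square[symmetric] flip: of_real_power)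
qed

text \<open>The Gaussian weight regularises \<open>\<integral> |fourier g|\<^sup>2\<close> so that Fubini applies; \<open>d \<rightarrow> 0\<close> removes it.\<close>

lemma integral_gaussian_norm_fourier:
  fixes g :: "'a::euclidean_space \<Rightarrow> complex"
  assumes g: "integrable lborel g" and d: "0 < d"
  shows "(\<integral>\<xi>. complex_of_real ((cmod (fourier g \<xi>))\<^sup>2) *
        complex_of_real (exp (- (norm (d *\<^sub>R \<xi>))\<^sup>2 / 2)) \<partial>lborel) =
      complex_of_real (sqrt (2 * pi) ^ DIM('a)) *
        (\<integral>x. autocorrelation g (d *\<^sub>R x) * complex_of_real (exp (- (norm x)\<^sup>2 / 2)) \<partial>lborel)"
proof -
  have "integrable lborel (\<lambda>\<xi>::'a. exp (- (norm (d *\<^sub>R \<xi>))\<^sup>2 / 2))"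
    using lborel_integrable_affine_iff[of d "\<lambda>x::'a. exp (- (norm x)\<^sup>2 / 2)" 0] d integrable_gaussian[where 'a = 'a]
    by simp
  then have W: "integrable lborel (\<lambda>\<xi>::'a. complex_of_real (exp (- (norm (d *\<^sub>R \<xi>))\<^sup>2 / 2)))"
    by (rule integrable_of_real)
  have "(\<integral>\<xi>. complex_of_real ((cmod (fourier g \<xi>))\<^sup>2) *
        complex_of_real (exp (- (norm (d *\<^sub>R \<xi>))\<^sup>2 / 2)) \<partial>lborel) =
      (\<integral>x. autocorrelation g x * complex_of_real (sqrt (2 * pi) ^ DIM('a) / d ^ DIM('a) *
        exp (- (norm (x /\<^sub>R d))\<^sup>2 / 2)) \<partial>lborel)"
    using fourier_multiplication[OF integrable_autocorrelation[OF g] W]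
    by (simp only: fourier_autocorrelation[OF g] fourier_scaled_gaussian[OF d])
  also have "\<dots> = \<bar>d\<bar> ^ DIM('a) *\<^sub>R (\<integral>x. autocorrelation g (0 + d *\<^sub>R x) *
      complex_of_real (sqrt (2 * pi) ^ DIM('a) / d ^ DIM('a) *
        exp (- (norm ((0 + d *\<^sub>R x) /\<^sub>R d))\<^sup>2 / 2)) \<partial>lborel)"
    using d by (intro lborel_integral_affine) auto
  also have "\<dots> = (\<integral>x. complex_of_real (sqrt (2 * pi) ^ DIM('a)) *
      (autocorrelation g (d *\<^sub>R x) * complex_of_real (exp (- (norm x)\<^sup>2 / 2))) \<partial>lborel)"
    unfolding integral_scaleR_right[symmetric]
    by (intro Bochner_Integration.integral_cong) (use d in \<open>auto simp: scaleR_conv_of_real\<close>)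
  finally show ?thesis
    by simp
qed

text \<open>The weighted identity is followed as the weight tends to 1. On the autocorrelation side
  dominated convergence leaves the value at 0; on the frequency side monotone convergence needs no
  finiteness in advance and thereby yields square integrability of the transform together with its
  norm.\<close>

theorem
  fixes g :: "'a::euclidean_space \<Rightarrow> complex"
  assumes g: "integrable lborel g" and g2: "square_integrable g"
  shows square_integrable_fourier: "square_integrable (fourier g)"
    and plancherel: "(L2_norm (fourier g))\<^sup>2 = (2 * pi) ^ DIM('a) * (L2_norm g)\<^sup>2"
proof -
  note [measurable] = square_integrable_measurable[OF g2]
  define d :: "nat \<Rightarrow> real" where "d k = inverse (Suc k)" for k
  have d: "0 < d k" for k by (simp add: d_def)
  have d0: "d \<longlonglongrightarrow> 0"
    unfolding d_def by (rule LIMSEQ_inverse_real_of_nat)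
  let ?W = "\<lambda>k \<xi>::'a. exp (- (norm (d k *\<^sub>R \<xi>))\<^sup>2 / 2)"
  let ?C = "(2 * pi) ^ DIM('a) * (L2_norm g)\<^sup>2"
  have iW: "integrable lborel (?W k)" for k
    using lborel_integrable_affine_iff[of "d k" "\<lambda>x::'a. exp (- (norm x)\<^sup>2 / 2)" 0] d[of k] integrable_gaussian[where 'a = 'a]
    by simp
  have int: "integrable lborel (\<lambda>\<xi>. (cmod (fourier g \<xi>))\<^sup>2 * ?W k \<xi>)" for k
  proof (rule Bochner_Integration.integrable_bound)
    show "integrable lborel (\<lambda>\<xi>. (\<integral>x. cmod (g x) \<partial>lborel)\<^sup>2 * ?W k \<xi>)"
      using iW by simp
    show "AE \<xi> in lborel. norm ((cmod (fourier g \<xi>))\<^sup>2 * ?W k \<xi>) \<le>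
        norm ((\<integral>x. cmod (g x) \<partial>lborel)\<^sup>2 * ?W k \<xi>)"
      using norm_fourier_le[of g] by (auto simp: abs_mult intro!: AE_I2 mult_right_mono power_mono)
  qed simp
  have "(\<lambda>k. \<integral>x. autocorrelation g (d k *\<^sub>R x) * complex_of_real (exp (- (norm x)\<^sup>2 / 2)) \<partial>lborel)
      \<longlonglongrightarrow> (\<integral>(x::'a). complex_of_real ((L2_norm g)\<^sup>2) * complex_of_real (exp (- (norm x)\<^sup>2 / 2)) \<partial>lborel)"
  proof (rule integral_dominated_convergence)
    show "integrable lborel (\<lambda>x::'a. (L2_norm g)\<^sup>2 * exp (- (norm x)\<^sup>2 / 2))"
      using integrable_gaussian[where 'a = 'a] by simp
    have "(\<lambda>k. d k *\<^sub>R x) \<longlonglongrightarrow> 0" for x :: 'a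
      using tendsto_scaleR[OF d0 tendsto_const[of x]] by simp
    then show "AE x in lborel. (\<lambda>k. autocorrelation g (d k *\<^sub>R x) * complex_of_real (exp (- (norm x)\<^sup>2 / 2)))
        \<longlonglongrightarrow> complex_of_real ((L2_norm g)\<^sup>2) * complex_of_real (exp (- (norm x)\<^sup>2 / 2))"
      by (intro AE_I2 tendsto_mult tendsto_const autocorrelation_tendsto g2)
    show "AE x in lborel. norm (autocorrelation g (d k *\<^sub>R x) * complex_of_real (exp (- (norm x)\<^sup>2 / 2)))
        \<le> (L2_norm g)\<^sup>2 * exp (- (norm x)\<^sup>2 / 2)" for k
      using norm_autocorrelation_le[OF g2] by (auto simp: norm_mult)
  qed measurable
  then have "(\<lambda>k. complex_of_real (sqrt (2 * pi) ^ DIM('a)) *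
      (\<integral>x. autocorrelation g (d k *\<^sub>R x) * complex_of_real (exp (- (norm x)\<^sup>2 / 2)) \<partial>lborel))
      \<longlonglongrightarrow> complex_of_real (sqrt (2 * pi) ^ DIM('a)) *
        (\<integral>(x::'a). complex_of_real ((L2_norm g)\<^sup>2) * complex_of_real (exp (- (norm x)\<^sup>2 / 2)) \<partial>lborel)"
    by (rule tendsto_mult_left)
  \<comment> \<open>The mass of the Gaussian is read off as its transform at frequency 0. It
    supplies the second factor sqrt (2 pi)^n of the constant.\<close>
  also have "(\<integral>(x::'a). complex_of_real ((L2_norm g)\<^sup>2) * complex_of_real (exp (- (norm x)\<^sup>2 / 2)) \<partial>lborel) =
      complex_of_real ((L2_norm g)\<^sup>2 * sqrt (2 * pi) ^ DIM('a))"
    using fourier_gaussian[of "0::'a"] by (simp add: fourier_def)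
  also have "complex_of_real (sqrt (2 * pi) ^ DIM('a)) * complex_of_real ((L2_norm g)\<^sup>2 * sqrt (2 * pi) ^ DIM('a)) =
      complex_of_real ?C"
  proof -
    have "sqrt (2 * pi) ^ DIM('a) * sqrt (2 * pi) ^ DIM('a) = (2 * pi) ^ DIM('a)"
      unfolding power_mult_distrib[symmetric] by simp
    then show ?thesis
      unfolding of_real_mult[symmetric] by (metis mult.assoc mult.commute)
  qed
  finally have "(\<lambda>k. complex_of_real (\<integral>\<xi>. (cmod (fourier g \<xi>))\<^sup>2 * ?W k \<xi> \<partial>lborel)) \<longlonglongrightarrow> complex_of_real ?C"
    by (simp only: integral_gaussian_norm_fourier[OF g d, symmetric] of_real_mult[symmetric]
        integral_complex_of_real)
  then have "(\<lambda>k. \<integral>\<xi>. (cmod (fourier g \<xi>))\<^sup>2 * ?W k \<xi> \<partial>lborel) \<longlonglongrightarrow> ?C"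
    by (simp only: tendsto_of_real_iff)
  then have lim1: "(\<lambda>k. ennreal (\<integral>\<xi>. (cmod (fourier g \<xi>))\<^sup>2 * ?W k \<xi> \<partial>lborel)) \<longlonglongrightarrow> ennreal ?C"
    by (rule tendsto_ennrealI)
  have nn: "(\<integral>\<^sup>+\<xi>. ennreal ((cmod (fourier g \<xi>))\<^sup>2 * ?W k \<xi>) \<partial>lborel) =
      ennreal (\<integral>\<xi>. (cmod (fourier g \<xi>))\<^sup>2 * ?W k \<xi> \<partial>lborel)" for k
    using int by (intro nn_integral_eq_integral) auto
  \<comment> \<open>The weights increase to 1 because d decreases to 0.\<close>
  have lim2: "(\<lambda>k. \<integral>\<^sup>+\<xi>. ennreal ((cmod (fourier g \<xi>))\<^sup>2 * ?W k \<xi>) \<partial>lborel) \<longlonglongrightarrow> L2_sqnorm (fourier g)"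
    unfolding L2_sqnorm_def
  proof (rule nn_integral_LIMSEQ)
    show "incseq (\<lambda>k \<xi>. ennreal ((cmod (fourier g \<xi>))\<^sup>2 * ?W k \<xi>))"
    proof (intro incseq_SucI le_funI ennreal_leI mult_left_mono)
      fix k and \<xi> :: 'a
      have "d (Suc k) \<le> d k"
        by (simp add: d_def)
      then have "norm (d (Suc k) *\<^sub>R \<xi>) \<le> norm (d k *\<^sub>R \<xi>)"
        using d[of "Suc k"] d[of k] by (auto intro!: mult_right_mono)
      then show "?W k \<xi> \<le> ?W (Suc k) \<xi>"
        by (simp add: power_mono)
    qed simp
    fix \<xi> :: 'a
    have "(\<lambda>k. (cmod (fourier g \<xi>))\<^sup>2 * ?W k \<xi>) \<longlonglongrightarrow> (cmod (fourier g \<xi>))\<^sup>2 * exp (- (norm (0 *\<^sub>R \<xi>))\<^sup>2 / 2)"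
      by (intro tendsto_intros d0) auto
    then show "(\<lambda>k. ennreal ((cmod (fourier g \<xi>))\<^sup>2 * ?W k \<xi>)) \<longlonglongrightarrow> ennreal ((cmod (fourier g \<xi>))\<^sup>2)"
      by (intro tendsto_ennrealI) simp
  qed simp
  have eq: "L2_sqnorm (fourier g) = ennreal ?C"
    by (rule LIMSEQ_unique[OF lim2[unfolded nn] lim1])
  then show F: "square_integrable (fourier g)"
    by (simp add: square_integrable_def)
  have "ennreal ((L2_norm (fourier g))\<^sup>2) = ennreal ?C"
    using L2_sqnorm_eq[OF F] eq by simp
  then show "(L2_norm (fourier g))\<^sup>2 = ?C"
    by (subst (asm) ennreal_inj) auto
qed

section \<open>Completeness and surjectivity of the L2 Fourier transform\<close>

text \<open>The Riesz-Fischer argument: a rapidly Cauchy subsequence converges almost everywhere,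
  and Fatou's lemma upgrades this to convergence of the whole sequence in norm.\<close>

lemma L2_complete:
  fixes u :: "nat \<Rightarrow> 'a::euclidean_space \<Rightarrow> complex"
  assumes u: "\<And>k. square_integrable (u k)"
    and cauchy: "\<And>e. 0 < e \<Longrightarrow> \<exists>K. \<forall>k\<ge>K. \<forall>l\<ge>K. L2_norm (\<lambda>x. u k x - u l x) < e"
  shows "\<exists>v. square_integrable v \<and> (\<lambda>k. L2_norm (\<lambda>x. u k x - v x)) \<longlonglongrightarrow> 0"
proof -
  note [measurable] = square_integrable_measurable[OF u]
  \<comment> \<open>The rate 4^-j leaves room for a weight: squared increments are below 16^-j, so
    after multiplication by 4^j their integrals are still summable. Finiteness of the weighted sum
    at a point then forces increments there of order 2^-j.\<close>
  have "\<exists>K. \<forall>k\<ge>K. \<forall>l\<ge>K. L2_norm (\<lambda>x. u k x - u l x) < (1 / 4) ^ j" for j :: nat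
    by (rule cauchy) simp
  then obtain K where K: "\<And>j k l. k \<ge> K j \<Longrightarrow> l \<ge> K j \<Longrightarrow> L2_norm (\<lambda>x. u k x - u l x) < (1 / 4) ^ j"
    by metis
  \<comment> \<open>Summing all earlier thresholds makes the indices monotone and at least
    \<open>K j\<close>; the added j makes them tend to infinity.\<close>
  define r where "r j = (\<Sum>i\<le>j. K i) + j" for j
  have r: "K j \<le> r j" "r j \<le> r (Suc j)" "j \<le> r j" for j
    using member_le_sum[of j "{..j}" K] by (auto simp: r_def)
  define w where "w j = u (r j)" for j
  have [measurable]: "w j \<in> borel_measurable borel" for j
    by (simp add: w_def)
  have sqw: "square_integrable (w j)" for j
    by (simp add: w_def u)
  \<comment> \<open>\<open>lim\<close> is total, which makes v measurable everywhere; its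
    unspecified values occur only on the null set where the subsequence fails to converge.\<close>
  define v where "v x = lim (\<lambda>j. w j x)" for x
  have [measurable]: "v \<in> borel_measurable borel"
    unfolding v_def[abs_def] by measurable
  have "(\<integral>\<^sup>+x. ennreal (4 ^ j * (cmod (w (Suc j) x - w j x))\<^sup>2) \<partial>lborel) \<le> ennreal ((1 / 4) ^ j)" for j
  proof -
    have "(\<integral>\<^sup>+x. ennreal (4 ^ j * (cmod (w (Suc j) x - w j x))\<^sup>2) \<partial>lborel) =
        ennreal (4 ^ j) * L2_sqnorm (\<lambda>x. w (Suc j) x - w j x)"
      by (simp add: L2_sqnorm_def ennreal_mult nn_integral_cmult)
    also have "\<dots> = ennreal (4 ^ j * (L2_norm (\<lambda>x. w (Suc j) x - w j x))\<^sup>2)"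
      using square_integrable_diff[OF sqw sqw] by (simp add: L2_sqnorm_eq ennreal_mult)
    also have "\<dots> \<le> ennreal (4 ^ j * ((1 / 4) ^ j)\<^sup>2)"
      using K[of j "r (Suc j)" "r j"] r[of j]
      by (intro ennreal_leI mult_left_mono power_mono) (auto simp: w_def)
    also have "4 ^ j * ((1 / 4) ^ j)\<^sup>2 = (1 / 4 :: real) ^ j"
      by (simp add: power2_eq_square power_divide)
    finally show ?thesis .
  qed
  then have "(\<integral>\<^sup>+x. (\<Sum>j. ennreal (4 ^ j * (cmod (w (Suc j) x - w j x))\<^sup>2)) \<partial>lborel) \<le>
      (\<Sum>j. ennreal ((1 / 4) ^ j))"
    by (subst nn_integral_suminf) (auto intro!: suminf_le)
  also have "\<dots> < \<infinity>"
    by (subst suminf_ennreal2) (auto intro!: summable_geometric)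
  finally have "AE x in lborel. (\<Sum>j. ennreal (4 ^ j * (cmod (w (Suc j) x - w j x))\<^sup>2)) \<noteq> \<infinity>"
    by (intro nn_integral_PInf_AE) auto
  then have lim: "AE x in lborel. (\<lambda>j. w j x) \<longlonglongrightarrow> v x"
  proof eventually_elim
    case (elim x)
    define F where "F j = ennreal (4 ^ j * (cmod (w (Suc j) x - w j x))\<^sup>2)" for j
    have "suminf F \<noteq> top"
      using elim by (simp only: F_def[abs_def] infinity_ennreal_def not_False_eq_True)
    then obtain C where C: "suminf F = ennreal C" "0 \<le> C"
      by (cases "suminf F") auto
    have le: "cmod (w (Suc j) x - w j x) \<le> sqrt C * (1 / 2) ^ j" for j
    proof -
      have "sum F {j} \<le> suminf F"
        by (rule sum_le_suminf) auto
      then have "ennreal (4 ^ j * (cmod (w (Suc j) x - w j x))\<^sup>2) \<le> ennreal C"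
        using C by (simp add: F_def)
      then have "4 ^ j * (cmod (w (Suc j) x - w j x))\<^sup>2 \<le> C"
        using C(2) by (simp only: ennreal_le_iff)
      moreover have "(2 ^ j)\<^sup>2 = (4 :: real) ^ j"
        by (simp add: power2_eq_square flip: power_mult_distrib)
      ultimately have "(2 ^ j * cmod (w (Suc j) x - w j x))\<^sup>2 \<le> C"
        by (simp only: power_mult_distrib)
      then have "2 ^ j * cmod (w (Suc j) x - w j x) \<le> sqrt C"
        by (rule real_le_rsqrt)
      then show ?thesis
        by (simp add: field_simps)
    qed
    have "summable (\<lambda>j. w (Suc j) x - w j x)"
      by (rule summable_comparison_test'[of "\<lambda>j. sqrt C * (1 / 2) ^ j" 0])
        (auto intro!: summable_mult summable_geometric le)
    then have "convergent (\<lambda>j. w j x)"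
      by (simp only: summable_iff_convergent sum_lessThan_telescope[of "\<lambda>j. w j x"]
          convergent_diff_const_right_iff)
    then show ?case
      by (simp add: v_def convergent_LIMSEQ_iff)
  qed
  \<comment> \<open>Sending the second index to infinity along the subsequence turns the Cauchy
    estimate into one against v. It is used once with bound 1 to place v in L2, and again for the
    convergence.\<close>
  have fatou: "L2_sqnorm (\<lambda>x. u k x - v x) \<le> ennreal (e\<^sup>2)"
    if e: "0 < e" and le: "\<And>k l. k \<ge> N \<Longrightarrow> l \<ge> N \<Longrightarrow> L2_norm (\<lambda>x. u k x - u l x) < e" and k: "k \<ge> N" for k e N
  proof -
    have "L2_sqnorm (\<lambda>x. u k x - v x) =
        (\<integral>\<^sup>+x. liminf (\<lambda>j. ennreal ((cmod (u k x - w j x))\<^sup>2)) \<partial>lborel)"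
      unfolding L2_sqnorm_def
    proof (rule nn_integral_cong_AE)
      show "AE x in lborel. ennreal ((cmod (u k x - v x))\<^sup>2) = liminf (\<lambda>j. ennreal ((cmod (u k x - w j x))\<^sup>2))"
        using lim
      proof eventually_elim
        case (elim x)
        have "(\<lambda>j. ennreal ((cmod (u k x - w j x))\<^sup>2)) \<longlonglongrightarrow> ennreal ((cmod (u k x - v x))\<^sup>2)"
          by (intro tendsto_ennrealI tendsto_intros elim)
        then show ?case
          by (intro lim_imp_Liminf[symmetric]) auto
      qed
    qed
    also have "\<dots> \<le> liminf (\<lambda>j. L2_sqnorm (\<lambda>x. u k x - w j x))"
      unfolding L2_sqnorm_def by (rule nn_integral_liminf) simp
    also have "\<dots> \<le> ennreal (e\<^sup>2)"
    proof (rule Liminf_le)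
      show "\<forall>\<^sub>F j in sequentially. L2_sqnorm (\<lambda>x. u k x - w j x) \<le> ennreal (e\<^sup>2)"
        using eventually_ge_at_top[of N]
      proof eventually_elim
        case (elim j)
        have "L2_norm (\<lambda>x. u k x - w j x) < e"
          using le[OF k, of "r j"] r(3)[of j] elim by (simp add: w_def)
        then show ?case
          using square_integrable_diff[OF u sqw] by (simp add: L2_sqnorm_eq power_mono)
      qed
    qed simp
    finally show ?thesis .
  qed
  obtain N where "\<And>k l. k \<ge> N \<Longrightarrow> l \<ge> N \<Longrightarrow> L2_norm (\<lambda>x. u k x - u l x) < 1"
    using cauchy[of 1] by auto
  from fatou[OF _ this, of N] have "square_integrable (\<lambda>x. u N x - v x)"
    by (simp add: square_integrable_def le_less_trans[OF _ ennreal_less_top[of 1]])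
  from square_integrable_diff[OF u this, of N] have v: "square_integrable v"
    by simp
  have "(\<lambda>k. L2_norm (\<lambda>x. u k x - v x)) \<longlonglongrightarrow> 0"
  proof (rule LIMSEQ_I)
    fix e :: real assume "0 < e"
    then obtain N where N: "\<And>k l. k \<ge> N \<Longrightarrow> l \<ge> N \<Longrightarrow> L2_norm (\<lambda>x. u k x - u l x) < e / 2"
      using cauchy[of "e / 2"] by auto
    have "L2_norm (\<lambda>x. u k x - v x) < e" if "k \<ge> N" for k
    proof -
      have "(L2_norm (\<lambda>x. u k x - v x))\<^sup>2 \<le> (e / 2)\<^sup>2"
        using fatou[OF _ N that] \<open>0 < e\<close> square_integrable_diff[OF u v]
        by (simp add: L2_sqnorm_eq)
      then have "L2_norm (\<lambda>x. u k x - v x) \<le> e / 2"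
        by (rule power2_le_imp_le) (use \<open>0 < e\<close> in simp)
      then show ?thesis
        using \<open>0 < e\<close> by simp
    qed
    then show "\<exists>N. \<forall>k\<ge>N. norm (L2_norm (\<lambda>x. u k x - v x) - 0) < e"
      by auto
  qed
  with v show ?thesis
    by blast
qed

text \<open>Cutting off to balls produces approximants in both L1 and L2, as
  \<open>has_L2_fourier\<close> demands; integrability holds because the indicator of a ball is
  itself in L2.\<close>

lemma
  fixes g :: "'a::euclidean_space \<Rightarrow> complex"
  assumes g: "square_integrable g"
  shows integrable_truncation: "integrable lborel (\<lambda>x. indicator (cball 0 r) x * g x)"
    and square_integrable_truncation: "square_integrable (\<lambda>x. indicator (cball 0 r) x * g x)"
    and L2_norm_truncation_tendsto:
      "(\<lambda>k. L2_norm (\<lambda>x. indicator (cball 0 (real k)) x * g x - g x)) \<longlonglongrightarrow> 0"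
proof -
  note [measurable] = square_integrable_measurable[OF g]
  have [measurable]: "(indicator (cball 0 r) :: 'a \<Rightarrow> complex) \<in> borel_measurable borel" for r
    by (intro borel_measurable_indicator) auto
  have "integrable lborel (indicator (cball (0::'a) r) :: 'a \<Rightarrow> real)"
    using emeasure_lborel_cball_finite[of "0::'a" r] by (simp add: integrable_indicator_iff)
  moreover have "(cmod (indicator (cball 0 r) x))\<^sup>2 = indicator (cball 0 r) x" for x :: 'a
    by (simp add: indicator_def)
  ultimately have "square_integrable (indicator (cball 0 r) :: 'a \<Rightarrow> complex)"
    by (simp add: square_integrable_iff)
  from integrable_mult_L2[OF this g] show "integrable lborel (\<lambda>x. indicator (cball 0 r) x * g x)" .
  show sq: "square_integrable (\<lambda>x. indicator (cball 0 r) x * g x)" for r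
    unfolding square_integrable_iff
  proof
    show "integrable lborel (\<lambda>x. (cmod (indicator (cball 0 r) x * g x))\<^sup>2)"
      by (rule Bochner_Integration.integrable_bound[OF square_integrable_integrable[OF g]])
        (auto simp: indicator_def)
  qed simp
  have "(\<lambda>k. \<integral>x. (cmod (indicator (cball 0 (real k)) x * g x - g x))\<^sup>2 \<partial>lborel) \<longlonglongrightarrow> (\<integral>(x::'a). 0 \<partial>lborel)"
  proof (rule integral_dominated_convergence[OF _ _ square_integrable_integrable[OF g]])
    show "AE x in lborel. (\<lambda>k. (cmod (indicator (cball 0 (real k)) x * g x - g x))\<^sup>2) \<longlonglongrightarrow> 0"
    proof (rule AE_I2)
      fix x :: 'a
      obtain N :: nat where "norm x \<le> real N"
        using real_arch_simple by blast
      then have "(cmod (indicator (cball 0 (real k)) x * g x - g x))\<^sup>2 = 0" if "k \<ge> N" for k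
        using that by (simp add: indicator_def)
      then show "(\<lambda>k. (cmod (indicator (cball 0 (real k)) x * g x - g x))\<^sup>2) \<longlonglongrightarrow> 0"
        by (intro tendsto_eventually eventually_sequentiallyI)
    qed
  qed (auto simp: indicator_def)
  from tendsto_real_sqrt[OF this]
  show "(\<lambda>k. L2_norm (\<lambda>x. indicator (cball 0 (real k)) x * g x - g x)) \<longlonglongrightarrow> 0"
    by (simp add: L2_norm_def)
qed

lemma fourier_add:
  "integrable lborel f \<Longrightarrow> integrable lborel g \<Longrightarrow>
    fourier (\<lambda>x. f x + g x) \<xi> = fourier f \<xi> + fourier g \<xi>"
  using integrable_iexp_mult[of f \<xi>] integrable_iexp_mult[of g \<xi>]
  by (simp add: fourier_def distrib_left)

lemma fourier_cmult: "fourier (\<lambda>x. c * f x) \<xi> = c * fourier f \<xi>"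
  unfolding fourier_def by (subst integral_mult_right_zero[symmetric]) (simp add: mult_ac)

lemma fourier_diff:
  "integrable lborel f \<Longrightarrow> integrable lborel g \<Longrightarrow>
    fourier (\<lambda>x. f x - g x) \<xi> = fourier f \<xi> - fourier g \<xi>"
  using integrable_iexp_mult[of f \<xi>] integrable_iexp_mult[of g \<xi>]
  by (simp add: fourier_def right_diff_distrib)

lemma fourier_cnj: "fourier (\<lambda>x. cnj (f x)) \<xi> = cnj (fourier f (- \<xi>))"
  unfolding fourier_def Bochner_Integration.integral_cnj[symmetric]
  by (intro Bochner_Integration.integral_cong) (auto simp: exp_cnj)

text \<open>Expansion of a squared norm, the source of all polarisation arguments below. Only the
  real part of the inner product appears.\<close>

lemma L2_norm_add_power2:
  assumes f: "square_integrable f" and g: "square_integrable g"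
  shows "(L2_norm (\<lambda>x. f x + g x))\<^sup>2 =
    (L2_norm f)\<^sup>2 + (L2_norm g)\<^sup>2 + 2 * Re (\<integral>x. f x * cnj (g x) \<partial>lborel)"
proof -
  have "(L2_norm (\<lambda>x. f x + g x))\<^sup>2 =
      (\<integral>x. (cmod (f x))\<^sup>2 + (cmod (g x))\<^sup>2 + 2 * Re (f x * cnj (g x)) \<partial>lborel)"
    unfolding L2_norm_power2
    unfolding cmod_power2
    by (intro Bochner_Integration.integral_cong) (auto simp: power2_eq_square algebra_simps)
  also have "\<dots> = (L2_norm f)\<^sup>2 + (L2_norm g)\<^sup>2 + 2 * Re (\<integral>x. f x * cnj (g x) \<partial>lborel)"
    using square_integrable_integrable[OF f] square_integrable_integrable[OF g]
      integrable_mult_L2[OF f square_integrable_cnj[OF g]]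
    by (simp add: L2_norm_power2 del: times_complex.simps)
  finally show ?thesis .
qed

text \<open>Up to a constant the Fourier transform is an isometry whose formal adjoint is again an isometry.
  Hence approximating the inverse transform of \<open>h\<close> by \<open>s\<close> automatically makes \<open>fourier s\<close> approximate \<open>h\<close>,
  which gives surjectivity without an inversion theorem.\<close>

lemma L2_norm_fourier_diff:
  fixes s h :: "'a::euclidean_space \<Rightarrow> complex"
  assumes s: "integrable lborel s" "square_integrable s"
    and h: "integrable lborel h" "square_integrable h"
  shows "(L2_norm (\<lambda>\<xi>. fourier s \<xi> - h \<xi>))\<^sup>2 = (2 * pi) ^ DIM('a) *
    (L2_norm (\<lambda>x. s x - complex_of_real (1 / (2 * pi) ^ DIM('a)) * fourier h (- x)))\<^sup>2"
proof -
  let ?c = "(2 * pi) ^ DIM('a)"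
  \<comment> \<open>The minus sign is absorbed here so that the difference becomes a sum to which
    \<open>L2_norm_add_power2\<close> applies.\<close>
  let ?w = "\<lambda>x. complex_of_real (- 1 / ?c) * fourier h (- x)"
  have nc: "cmod (complex_of_real (- 1 / ?c)) = 1 / ?c"
    unfolding norm_of_real by simp
  have w: "square_integrable ?w"
    by (intro square_integrable_cmult square_integrable_reflect square_integrable_fourier h)
  have mh: "square_integrable (\<lambda>x. -1 * h x)"
    by (rule square_integrable_cmult[OF h(2)])
  \<comment> \<open>The adjoint relation: the multiplication formula with conjugated h, where
    conjugation reverses the frequency. With Plancherel for s and for h, it makes the expansions of
    both sides agree term by term.\<close>
  have "(\<integral>x. fourier s x * cnj (h x) \<partial>lborel) = (\<integral>x. s x * cnj (fourier h (- x)) \<partial>lborel)"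
    using fourier_multiplication[OF s(1), of "\<lambda>x. cnj (h x)"] h by (simp add: fourier_cnj)
  moreover have "(\<integral>x. s x * cnj (?w x) \<partial>lborel) =
      complex_of_real (- 1 / ?c) * (\<integral>x. s x * cnj (fourier h (- x)) \<partial>lborel)"
    by (subst integral_mult_right_zero[symmetric]) (simp add: mult_ac)
  ultimately have w1: "(\<integral>x. s x * cnj (?w x) \<partial>lborel) =
      complex_of_real (- 1 / ?c) * (\<integral>x. fourier s x * cnj (h x) \<partial>lborel)"
    by simp
  have Re_mult: "Re (complex_of_real r * z) = r * Re z" for r z
    by simp
  have w2: "(L2_norm ?w)\<^sup>2 = (L2_norm h)\<^sup>2 / ?c"
    unfolding L2_norm_cmult L2_norm_reflect nc power_mult_distrib[of "1 / ?c"] plancherel[OF h]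
    by (simp add: power2_eq_square)
  have "?c * (L2_norm (\<lambda>x. s x + ?w x))\<^sup>2 =
      ?c * (L2_norm s)\<^sup>2 + (L2_norm h)\<^sup>2 - 2 * Re (\<integral>x. fourier s x * cnj (h x) \<partial>lborel)"
    unfolding L2_norm_add_power2[OF s(2) w] w1 w2 Re_mult by (simp add: field_simps)
  also have "\<dots> = (L2_norm (\<lambda>\<xi>. fourier s \<xi> + -1 * h \<xi>))\<^sup>2"
    unfolding L2_norm_add_power2[OF square_integrable_fourier[OF s] mh] plancherel[OF s] L2_norm_cmult
    by simp
  finally show ?thesis
    by simp
qed

lemma has_L2_fourier_iff:
  "has_L2_fourier g h \<longleftrightarrow> square_integrable g \<and> square_integrable h \<and>
     (\<exists>s. (\<forall>k::nat. integrable lborel (s k) \<and> square_integrable (s k)) \<and>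
        (\<lambda>k. L2_norm (\<lambda>x. s k x - g x)) \<longlonglongrightarrow> 0 \<and>
        (\<lambda>k. L2_norm (\<lambda>\<xi>. fourier (s k) \<xi> - h \<xi>)) \<longlonglongrightarrow> 0)"
  (is "_ \<longleftrightarrow> _ \<and> _ \<and> ?R")
proof (cases "square_integrable g \<and> square_integrable h")
  case True
  have "(\<lambda>k. L2_sqnorm (\<lambda>x. s k x - g x)) \<longlonglongrightarrow> 0 \<longleftrightarrow> (\<lambda>k. L2_norm (\<lambda>x. s k x - g x)) \<longlonglongrightarrow> 0"
    "(\<lambda>k. L2_sqnorm (\<lambda>\<xi>. fourier (s k) \<xi> - h \<xi>)) \<longlonglongrightarrow> 0 \<longleftrightarrow>
      (\<lambda>k. L2_norm (\<lambda>\<xi>. fourier (s k) \<xi> - h \<xi>)) \<longlonglongrightarrow> 0"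
    if "\<forall>k. integrable lborel (s k) \<and> square_integrable (s k)" for s :: "nat \<Rightarrow> 'a \<Rightarrow> complex"
    using that True
    by (auto intro!: L2_sqnorm_tendsto_0_iff square_integrable_diff square_integrable_fourier)
  then show ?thesis
    using True unfolding has_L2_fourier_def by (metis (no_types, lifting))
qed (auto simp: has_L2_fourier_def)

lemma has_L2_fourierD:
  assumes "has_L2_fourier g h"
  shows "square_integrable g" "square_integrable h"
  using assms by (auto simp: has_L2_fourier_def)

lemma has_L2_fourier_fourier:
  assumes "integrable lborel g" "square_integrable g"
  shows "has_L2_fourier g (fourier g)"
  unfolding has_L2_fourier_iff
  using assms square_integrable_fourier[OF assms]
  by (auto intro!: exI[of _ "\<lambda>_. g"] simp: L2_norm_def)

text \<open>Candidate inverse transforms w of truncations H of h form a Cauchy sequence by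
  Plancherel, and u is their limit. They need not be integrable, so they are cut off to s;
  \<open>L2_norm_fourier_diff\<close> converts closeness of s to w into closeness of
  \<open>fourier (s k)\<close> to \<open>H k\<close>.\<close>

lemma has_L2_fourier_surj:
  fixes h :: "'a::euclidean_space \<Rightarrow> complex"
  assumes h: "square_integrable h"
  shows "\<exists>u. has_L2_fourier u h"
proof -
  let ?c = "(2 * pi) ^ DIM('a)"
  have c: "0 < ?c" by simp
  define H where "H k x = indicator (cball 0 (real k)) x * h x" for k :: nat and x
  have H: "integrable lborel (H k)" "square_integrable (H k)" for k
    unfolding H_def[abs_def] using integrable_truncation[OF h] square_integrable_truncation[OF h] by auto
  have Hh: "(\<lambda>k. L2_norm (\<lambda>x. H k x - h x)) \<longlonglongrightarrow> 0"
    unfolding H_def using L2_norm_truncation_tendsto[OF h] .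
  define w where "w k x = complex_of_real (1 / ?c) * fourier (H k) (- x)" for k :: nat and x :: 'a
  have w: "square_integrable (w k)" for k
    unfolding w_def[abs_def]
    by (intro square_integrable_cmult square_integrable_reflect square_integrable_fourier H)
  have wd: "L2_norm (\<lambda>x. w k x - w l x) = L2_norm (\<lambda>x. H k x - H l x) / sqrt ?c" for k l
  proof -
    have "L2_norm (\<lambda>x. w k x - w l x) =
        L2_norm (\<lambda>x. complex_of_real (1 / ?c) * fourier (\<lambda>y. H k y - H l y) (- x))"
      by (simp add: w_def fourier_diff H right_diff_distrib)
    also have "\<dots> = 1 / ?c * L2_norm (fourier (\<lambda>y. H k y - H l y))"
      unfolding L2_norm_cmult L2_norm_reflect norm_of_real by simp
    also have "L2_norm (fourier (\<lambda>y. H k y - H l y)) = sqrt (?c * (L2_norm (\<lambda>y. H k y - H l y))\<^sup>2)"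
      using plancherel[of "\<lambda>y. H k y - H l y"] H
      by (intro real_sqrt_unique[symmetric]) (auto intro: square_integrable_diff)
    also have "\<dots> = sqrt ?c * L2_norm (\<lambda>y. H k y - H l y)"
      by (simp add: real_sqrt_mult)
    also have "1 / ?c * (sqrt ?c * L2_norm (\<lambda>y. H k y - H l y)) = L2_norm (\<lambda>x. H k x - H l x) / sqrt ?c"
      using real_sqrt_mult_self[of ?c] c by (simp add: field_simps)
    finally show ?thesis .
  qed
  have "\<exists>K. \<forall>k\<ge>K. \<forall>l\<ge>K. L2_norm (\<lambda>x. w k x - w l x) < e" if "0 < e" for e
  proof -
    have "0 < e * sqrt ?c / 2" using that by simp
    from order_tendstoD(2)[OF Hh this] obtain K where
      K: "\<And>k. k \<ge> K \<Longrightarrow> L2_norm (\<lambda>x. H k x - h x) < e * sqrt ?c / 2"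
      by (auto simp: eventually_sequentially)
    have "L2_norm (\<lambda>x. w k x - w l x) < e" if "k \<ge> K" "l \<ge> K" for k l
    proof -
      have "L2_norm (\<lambda>x. H k x - H l x) \<le> L2_norm (\<lambda>x. H k x - h x) + L2_norm (\<lambda>x. H l x - h x)"
        using L2_norm_triangle_diff[OF H(2) h H(2), of k l] by (simp add: L2_norm_minus_commute[of h])
      also have "\<dots> < e * sqrt ?c"
        using K[OF that(1)] K[OF that(2)] by simp
      finally show ?thesis
        unfolding wd by (simp add: divide_less_eq)
    qed
    then show ?thesis by blast
  qed
  from L2_complete[OF w this] obtain u where
    u: "square_integrable u" and wu: "(\<lambda>k. L2_norm (\<lambda>x. w k x - u x)) \<longlonglongrightarrow> 0"
    by blast
  \<comment> \<open>Each w k gets its own radius, large enough for the cut-off error to vanish along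
    the sequence.\<close>
  have "\<exists>r. L2_norm (\<lambda>x. indicator (cball 0 (real r)) x * w k x - w k x) < inverse (Suc k)" for k
    using order_tendstoD(2)[OF L2_norm_truncation_tendsto[OF w[of k]], of "inverse (Suc k)"]
    by (auto simp: eventually_sequentially)
  then obtain r where
    r: "\<And>k. L2_norm (\<lambda>x. indicator (cball 0 (real (r k))) x * w k x - w k x) < inverse (Suc k)"
    by metis
  define s where "s k x = indicator (cball 0 (real (r k))) x * w k x" for k x
  have s: "integrable lborel (s k)" "square_integrable (s k)" for k
    unfolding s_def[abs_def] using integrable_truncation[OF w] square_integrable_truncation[OF w] by auto
  have sw: "(\<lambda>k. L2_norm (\<lambda>x. s k x - w k x)) \<longlonglongrightarrow> 0"
    by (rule Lim_null_comparison[OF _ LIMSEQ_inverse_real_of_nat])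
      (use r in \<open>auto simp: s_def intro!: always_eventually less_imp_le\<close>)
  have "(\<lambda>k. L2_norm (\<lambda>x. s k x - u x)) \<longlonglongrightarrow> 0"
    by (rule Lim_null_comparison[OF _ tendsto_add_zero[OF sw wu]])
      (use L2_norm_triangle_diff[OF s(2) w u] in simp)
  moreover have "(\<lambda>k. L2_norm (\<lambda>\<xi>. fourier (s k) \<xi> - h \<xi>)) \<longlonglongrightarrow> 0"
  proof (rule Lim_null_comparison)
    show "(\<lambda>k. sqrt ?c * L2_norm (\<lambda>x. s k x - w k x) + L2_norm (\<lambda>x. H k x - h x)) \<longlonglongrightarrow> 0"
      by (intro tendsto_add_zero tendsto_mult_right_zero sw Hh)
    have "L2_norm (\<lambda>\<xi>. fourier (s k) \<xi> - H k \<xi>) = sqrt ?c * L2_norm (\<lambda>x. s k x - w k x)" for k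
    proof -
      have "L2_norm (\<lambda>\<xi>. fourier (s k) \<xi> - H k \<xi>) = sqrt (?c * (L2_norm (\<lambda>x. s k x - w k x))\<^sup>2)"
        using L2_norm_fourier_diff[OF s H, of k k]
        by (intro real_sqrt_unique[symmetric]) (auto simp: w_def)
      then show ?thesis
        by (simp add: real_sqrt_mult)
    qed
    then have "norm (L2_norm (\<lambda>\<xi>. fourier (s k) \<xi> - h \<xi>)) \<le>
        sqrt ?c * L2_norm (\<lambda>x. s k x - w k x) + L2_norm (\<lambda>x. H k x - h x)" for k
      using L2_norm_triangle_diff[OF square_integrable_fourier[OF s, of k] H(2)[of k] h] by simp
    then show "\<forall>\<^sub>F k in sequentially. norm (L2_norm (\<lambda>\<xi>. fourier (s k) \<xi> - h \<xi>)) \<le>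
        sqrt ?c * L2_norm (\<lambda>x. s k x - w k x) + L2_norm (\<lambda>x. H k x - h x)"
      by (intro always_eventually allI)
  qed
  ultimately show ?thesis
    unfolding has_L2_fourier_iff using u h s by blast
qed

section \<open>Parseval's identity and the Schroedinger group\<close>

lemma has_L2_fourier_norm:
  fixes g :: "'a::euclidean_space \<Rightarrow> complex"
  assumes "has_L2_fourier g h"
  shows "(L2_norm h)\<^sup>2 = (2 * pi) ^ DIM('a) * (L2_norm g)\<^sup>2"
proof -
  obtain s :: "nat \<Rightarrow> 'a \<Rightarrow> complex" where s: "\<And>k. integrable lborel (s k)" "\<And>k. square_integrable (s k)"
    and sg: "(\<lambda>k. L2_norm (\<lambda>x. s k x - g x)) \<longlonglongrightarrow> 0"
    and sh: "(\<lambda>k. L2_norm (\<lambda>\<xi>. fourier (s k) \<xi> - h \<xi>)) \<longlonglongrightarrow> 0"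
    using assms unfolding has_L2_fourier_iff by auto
  note gh = has_L2_fourierD[OF assms]
  have "(\<lambda>k. (L2_norm (fourier (s k)))\<^sup>2) \<longlonglongrightarrow> (L2_norm h)\<^sup>2"
    by (intro tendsto_power L2_norm_tendsto square_integrable_fourier s gh sh)
  moreover have "(\<lambda>k. (L2_norm (fourier (s k)))\<^sup>2) \<longlonglongrightarrow> (2 * pi) ^ DIM('a) * (L2_norm g)\<^sup>2"
    unfolding plancherel[OF s]
    by (intro tendsto_mult_left tendsto_power L2_norm_tendsto s gh sg)
  ultimately show ?thesis
    by (rule LIMSEQ_unique)
qed

section \<open>Stability of the L2 transform under linear operations, translation and
  modulation\<close>

lemma has_L2_fourierI:
  assumes "square_integrable g" "square_integrable h"
    and "\<And>k::nat. integrable lborel (s k)" "\<And>k. square_integrable (s k)"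
    and "(\<lambda>k. L2_norm (\<lambda>x. s k x - g x)) \<longlonglongrightarrow> 0"
    and "(\<lambda>k. L2_norm (\<lambda>\<xi>. fourier (s k) \<xi> - h \<xi>)) \<longlonglongrightarrow> 0"
  shows "has_L2_fourier g h"
  unfolding has_L2_fourier_iff using assms by blast

lemma has_L2_fourierE:
  assumes "has_L2_fourier g h"
  obtains s where "\<And>k::nat. integrable lborel (s k)" "\<And>k. square_integrable (s k)"
    "(\<lambda>k. L2_norm (\<lambda>x. s k x - g x)) \<longlonglongrightarrow> 0"
    "(\<lambda>k. L2_norm (\<lambda>\<xi>. fourier (s k) \<xi> - h \<xi>)) \<longlonglongrightarrow> 0"
  using assms unfolding has_L2_fourier_iff by auto

lemma has_L2_fourier_add:
  assumes 1: "has_L2_fourier g1 h1" and 2: "has_L2_fourier g2 h2"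
  shows "has_L2_fourier (\<lambda>x. g1 x + g2 x) (\<lambda>\<xi>. h1 \<xi> + h2 \<xi>)"
proof -
  obtain s1 :: "nat \<Rightarrow> 'a \<Rightarrow> complex" where s1: "\<And>k. integrable lborel (s1 k)" "\<And>k. square_integrable (s1 k)"
    and l1: "(\<lambda>k. L2_norm (\<lambda>x. s1 k x - g1 x)) \<longlonglongrightarrow> 0" "(\<lambda>k. L2_norm (\<lambda>\<xi>. fourier (s1 k) \<xi> - h1 \<xi>)) \<longlonglongrightarrow> 0"
    using 1 by (rule has_L2_fourierE) blast
  obtain s2 :: "nat \<Rightarrow> 'a \<Rightarrow> complex" where s2: "\<And>k. integrable lborel (s2 k)" "\<And>k. square_integrable (s2 k)"
    and l2: "(\<lambda>k. L2_norm (\<lambda>x. s2 k x - g2 x)) \<longlonglongrightarrow> 0" "(\<lambda>k. L2_norm (\<lambda>\<xi>. fourier (s2 k) \<xi> - h2 \<xi>)) \<longlonglongrightarrow> 0"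
    using 2 by (rule has_L2_fourierE) blast
  note D = has_L2_fourierD[OF 1] has_L2_fourierD[OF 2]
  have add0: "(\<lambda>k. L2_norm (\<lambda>x. p1 k x + p2 k x - (q1 x + q2 x))) \<longlonglongrightarrow> 0"
    if "\<And>k. square_integrable (p1 k)" "\<And>k. square_integrable (p2 k)"
      and "square_integrable q1" "square_integrable q2"
      and "(\<lambda>k. L2_norm (\<lambda>x. p1 k x - q1 x)) \<longlonglongrightarrow> 0" "(\<lambda>k. L2_norm (\<lambda>x. p2 k x - q2 x)) \<longlonglongrightarrow> 0"
    for p1 p2 and q1 q2 :: "'a \<Rightarrow> complex"
  proof (rule Lim_null_comparison[OF _ tendsto_add_zero[OF that(5,6)]])
    have "L2_norm (\<lambda>x. p1 k x + p2 k x - (q1 x + q2 x)) \<le>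
        L2_norm (\<lambda>x. p1 k x - q1 x) + L2_norm (\<lambda>x. p2 k x - q2 x)" for k
      using L2_norm_triangle[OF square_integrable_diff[OF that(1,3), of k]
          square_integrable_diff[OF that(2,4), of k]]
      by (simp add: algebra_simps)
    then show "\<forall>\<^sub>F k in sequentially. norm (L2_norm (\<lambda>x. p1 k x + p2 k x - (q1 x + q2 x))) \<le>
        L2_norm (\<lambda>x. p1 k x - q1 x) + L2_norm (\<lambda>x. p2 k x - q2 x)"
      by simp
  qed
  show ?thesis
  proof (rule has_L2_fourierI[where s = "\<lambda>k x. s1 k x + s2 k x"])
    show "(\<lambda>k. L2_norm (\<lambda>x. s1 k x + s2 k x - (g1 x + g2 x))) \<longlonglongrightarrow> 0"
      by (rule add0) (use s1 s2 D l1 l2 in auto)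
    show "(\<lambda>k. L2_norm (\<lambda>\<xi>. fourier (\<lambda>x. s1 k x + s2 k x) \<xi> - (h1 \<xi> + h2 \<xi>))) \<longlonglongrightarrow> 0"
      unfolding fourier_add[OF s1(1) s2(1)]
      by (rule add0) (use s1 s2 D l1 l2 in \<open>auto intro: square_integrable_fourier\<close>)
  qed (use s1 s2 D in \<open>auto intro: square_integrable_add\<close>)
qed

lemma has_L2_fourier_cmult:
  assumes "has_L2_fourier g h"
  shows "has_L2_fourier (\<lambda>x. c * g x) (\<lambda>\<xi>. c * h \<xi>)"
  using assms
proof (rule has_L2_fourierE)
  fix s :: "nat \<Rightarrow> 'a \<Rightarrow> complex"
  assume s: "\<And>k. integrable lborel (s k)" "\<And>k. square_integrable (s k)"
    and l: "(\<lambda>k. L2_norm (\<lambda>x. s k x - g x)) \<longlonglongrightarrow> 0" "(\<lambda>k. L2_norm (\<lambda>\<xi>. fourier (s k) \<xi> - h \<xi>)) \<longlonglongrightarrow> 0"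
  show ?thesis
    by (rule has_L2_fourierI[where s = "\<lambda>k x. c * s k x"])
      (use s l has_L2_fourierD[OF assms] in \<open>auto simp: fourier_cmult L2_norm_cmult
        simp flip: right_diff_distrib intro: square_integrable_cmult tendsto_mult_right_zero\<close>)
qed

lemma has_L2_fourier_translate:
  assumes "has_L2_fourier g h"
  shows "has_L2_fourier (\<lambda>x. g (x + b)) (\<lambda>\<xi>. exp (\<i> * complex_of_real (b \<bullet> \<xi>)) * h \<xi>)"
  using assms
proof (rule has_L2_fourierE)
  fix s :: "nat \<Rightarrow> 'a \<Rightarrow> complex"
  assume s: "\<And>k. integrable lborel (s k)" "\<And>k. square_integrable (s k)"
    and l: "(\<lambda>k. L2_norm (\<lambda>x. s k x - g x)) \<longlonglongrightarrow> 0" "(\<lambda>k. L2_norm (\<lambda>\<xi>. fourier (s k) \<xi> - h \<xi>)) \<longlonglongrightarrow> 0"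
  show ?thesis
  proof (rule has_L2_fourierI[where s = "\<lambda>k x. s k (x + b)"])
    show "(\<lambda>k. L2_norm (\<lambda>x. s k (x + b) - g (x + b))) \<longlonglongrightarrow> 0"
      using l(1) L2_norm_translate[of "\<lambda>x. s _ x - g x" b] by simp
    show "(\<lambda>k. L2_norm (\<lambda>\<xi>. fourier (\<lambda>x. s k (x + b)) \<xi> - exp (\<i> * complex_of_real (b \<bullet> \<xi>)) * h \<xi>)) \<longlonglongrightarrow> 0"
      unfolding fourier_translate right_diff_distrib[symmetric]
      using l(2) by (subst L2_norm_unimodular) auto
    show "square_integrable (\<lambda>\<xi>. exp (\<i> * complex_of_real (b \<bullet> \<xi>)) * h \<xi>)"
      by (intro square_integrable_unimodular has_L2_fourierD[OF assms]) auto
  qed (use s has_L2_fourierD[OF assms] in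
      \<open>auto simp: lborel_integrable_translate_iff intro: square_integrable_translate\<close>)
qed

lemma has_L2_fourier_modulate:
  assumes "has_L2_fourier g h"
  shows "has_L2_fourier (\<lambda>x. exp (\<i> * complex_of_real (x \<bullet> \<eta>)) * g x) (\<lambda>\<xi>. h (\<xi> - \<eta>))"
  using assms
proof (rule has_L2_fourierE)
  fix s :: "nat \<Rightarrow> 'a \<Rightarrow> complex"
  assume s: "\<And>k. integrable lborel (s k)" "\<And>k. square_integrable (s k)"
    and l: "(\<lambda>k. L2_norm (\<lambda>x. s k x - g x)) \<longlonglongrightarrow> 0" "(\<lambda>k. L2_norm (\<lambda>\<xi>. fourier (s k) \<xi> - h \<xi>)) \<longlonglongrightarrow> 0"
  show ?thesis
  proof (rule has_L2_fourierI[where s = "\<lambda>k x. exp (\<i> * complex_of_real (x \<bullet> \<eta>)) * s k x"])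
    show "(\<lambda>k. L2_norm (\<lambda>x. exp (\<i> * complex_of_real (x \<bullet> \<eta>)) * s k x - exp (\<i> * complex_of_real (x \<bullet> \<eta>)) * g x)) \<longlonglongrightarrow> 0"
      unfolding right_diff_distrib[symmetric] using l(1) by (subst L2_norm_unimodular) auto
    show "(\<lambda>k. L2_norm (\<lambda>\<xi>. fourier (\<lambda>x. exp (\<i> * complex_of_real (x \<bullet> \<eta>)) * s k x) \<xi> - h (\<xi> - \<eta>))) \<longlonglongrightarrow> 0"
      unfolding fourier_modulate
      using l(2) L2_norm_translate[of "\<lambda>\<xi>. fourier (s _) \<xi> - h \<xi>" "- \<eta>"] by simp
    show "integrable lborel (\<lambda>x. exp (\<i> * complex_of_real (x \<bullet> \<eta>)) * s k x)" for k
      using integrable_iexp_mult[OF s(1), of "- \<eta>" k] by simp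
    show "square_integrable (\<lambda>\<xi>. h (\<xi> - \<eta>))"
      using square_integrable_translate[OF has_L2_fourierD(2)[OF assms], of "- \<eta>"] by simp
  qed (use s has_L2_fourierD[OF assms] in \<open>auto intro!: square_integrable_unimodular\<close>)
qed

text \<open>Polarisation: Plancherel for the sum with g2 gives equality of real parts. Since Im z =
  Re (-\<i> z), the imaginary parts follow from the same statement for -\<i> g1.\<close>

theorem parseval:
  fixes g1 g2 :: "'a::euclidean_space \<Rightarrow> complex"
  assumes 1: "has_L2_fourier g1 h1" and 2: "has_L2_fourier g2 h2"
  shows "(\<integral>\<xi>. h1 \<xi> * cnj (h2 \<xi>) \<partial>lborel) =
    complex_of_real ((2 * pi) ^ DIM('a)) * (\<integral>x. g1 x * cnj (g2 x) \<partial>lborel)"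
proof -
  let ?c = "(2 * pi) ^ DIM('a)"
  have Re: "Re (\<integral>\<xi>. h \<xi> * cnj (h2 \<xi>) \<partial>lborel) = ?c * Re (\<integral>x. g x * cnj (g2 x) \<partial>lborel)"
    if gh: "has_L2_fourier g h" for g h
  proof -
    have "(L2_norm h)\<^sup>2 + (L2_norm h2)\<^sup>2 + 2 * Re (\<integral>\<xi>. h \<xi> * cnj (h2 \<xi>) \<partial>lborel) =
        ?c * ((L2_norm g)\<^sup>2 + (L2_norm g2)\<^sup>2 + 2 * Re (\<integral>x. g x * cnj (g2 x) \<partial>lborel))"
      using has_L2_fourier_norm[OF has_L2_fourier_add[OF gh 2]] has_L2_fourierD[OF gh] has_L2_fourierD[OF 2]
      by (simp only: L2_norm_add_power2)
    then show ?thesis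
      using has_L2_fourier_norm[OF gh] has_L2_fourier_norm[OF 2] by (simp add: algebra_simps)
  qed
  have Im: "Im (\<integral>\<xi>. f \<xi> * cnj (f2 \<xi>) \<partial>lborel) = Re (\<integral>\<xi>. (- \<i> * f \<xi>) * cnj (f2 \<xi>) \<partial>lborel)"
    for f f2 :: "'a \<Rightarrow> complex"
    by (simp add: mult.assoc)
  have "Im (\<integral>\<xi>. h1 \<xi> * cnj (h2 \<xi>) \<partial>lborel) = ?c * Im (\<integral>x. g1 x * cnj (g2 x) \<partial>lborel)"
    unfolding Im by (rule Re[OF has_L2_fourier_cmult[OF 1]])
  moreover have "Re (complex_of_real r * z) = r * Re z" "Im (complex_of_real r * z) = r * Im z" for r z
    by simp_all
  ultimately show ?thesis
    using Re[OF 1] by (intro complex_eqI) (simp_all only:)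
qed

text \<open>Discharges the choice operator: \<open>fourier g\<close> and surjectivity provide a
  witness. The function h returned is the one tied to the chosen u, known only to be some L2
  transform of g.\<close>

lemma schroedinger_group_has_L2_fourier:
  fixes g :: "'a::euclidean_space \<Rightarrow> complex"
  assumes "integrable lborel g" "square_integrable g"
  obtains h where "has_L2_fourier g h"
    "has_L2_fourier (schroedinger_group t g) (\<lambda>\<xi>. exp (- \<i> * complex_of_real (t * (norm \<xi>)\<^sup>2)) * h \<xi>)"
proof -
  have "square_integrable (\<lambda>\<xi>. exp (- \<i> * complex_of_real (t * (norm \<xi>)\<^sup>2)) * fourier g \<xi>)"
    by (intro square_integrable_unimodular square_integrable_fourier assms)
      (auto simp: norm_exp_eq_Re)
  from has_L2_fourier_surj[OF this] has_L2_fourier_fourier[OF assms]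
  have "\<exists>u h. has_L2_fourier g h \<and>
      has_L2_fourier u (\<lambda>\<xi>. exp (- \<i> * complex_of_real (t * (norm \<xi>)\<^sup>2)) * h \<xi>)"
    by blast
  from someI_ex[OF this] that show ?thesis
    unfolding schroedinger_group_def by blast
qed

lemma
  fixes g :: "'a::euclidean_space \<Rightarrow> complex"
  assumes g: "integrable lborel g" "square_integrable g"
  shows square_integrable_schroedinger_group: "square_integrable (schroedinger_group t g)"
    and L2_norm_schroedinger_group: "L2_norm (schroedinger_group t g) = L2_norm g"
    and norm_character_schroedinger_group_le:
      "cmod (\<integral>x. exp (\<i> * complex_of_real (x \<bullet> \<eta>)) * complex_of_real ((cmod (schroedinger_group t g x))\<^sup>2) \<partial>lborel)
        \<le> (\<integral>x. cmod (g (x + (2 * t) *\<^sub>R \<eta>)) * cmod (g x) \<partial>lborel)"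
proof -
  let ?u = "schroedinger_group t g" and ?c = "(2 * pi) ^ DIM('a)"
  let ?E = "\<lambda>\<xi>::'a. exp (- \<i> * complex_of_real (t * (norm \<xi>)\<^sup>2))"
  let ?b = "(2 * t) *\<^sub>R \<eta>"
  obtain h where gh: "has_L2_fourier g h" and uh: "has_L2_fourier ?u (\<lambda>\<xi>. ?E \<xi> * h \<xi>)"
    using schroedinger_group_has_L2_fourier[OF g] by blast
  have unim: "cmod (?E \<xi>) = 1" for \<xi>
    by (simp add: norm_exp_eq_Re)
  show "square_integrable ?u"
    by (rule has_L2_fourierD[OF uh])
  have "?c * (L2_norm ?u)\<^sup>2 = ?c * (L2_norm g)\<^sup>2"
    unfolding has_L2_fourier_norm[OF gh, symmetric] has_L2_fourier_norm[OF uh, symmetric]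
    by (simp only: L2_norm_unimodular[OF unim])
  then show "L2_norm ?u = L2_norm g"
    by (simp add: power2_eq_iff_nonneg)
  let ?g = "\<lambda>x. exp (\<i> * complex_of_real (x \<bullet> \<eta>)) * g x"
  \<comment> \<open>Since |\<xi> - \<eta>|^2 - |\<xi>|^2 = |\<eta>|^2 - 2 \<eta> \<bullet> \<xi>,
    the quadratic phases cancel. What remains is a constant and the phase of a translation by 2 t
    \<eta>, whence ?b.\<close>
  have E: "?E (\<xi> - \<eta>) * cnj (?E \<xi>) = ?E \<eta> * exp (\<i> * complex_of_real (?b \<bullet> \<xi>))" for \<xi>
    by (simp add: exp_cnj power2_norm_eq_inner inner_diff_left inner_diff_right inner_commute algebra_simps
        flip: exp_add)
  have "complex_of_real ?c * (\<integral>x. exp (\<i> * complex_of_real (x \<bullet> \<eta>)) * ?u x * cnj (?u x) \<partial>lborel) =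
      (\<integral>\<xi>. (?E (\<xi> - \<eta>) * h (\<xi> - \<eta>)) * cnj (?E \<xi> * h \<xi>) \<partial>lborel)"
    by (rule parseval[OF has_L2_fourier_modulate[OF uh] uh, symmetric])
  also have "\<dots> = (\<integral>\<xi>. ?E \<eta> * (exp (\<i> * complex_of_real (?b \<bullet> \<xi>)) * h (\<xi> - \<eta>) * cnj (h \<xi>)) \<partial>lborel)"
  proof (intro Bochner_Integration.integral_cong refl)
    fix \<xi>
    have "(?E (\<xi> - \<eta>) * h (\<xi> - \<eta>)) * cnj (?E \<xi> * h \<xi>) =
        (?E (\<xi> - \<eta>) * cnj (?E \<xi>)) * (h (\<xi> - \<eta>) * cnj (h \<xi>))"
      by (simp only: complex_cnj_mult mult_ac)
    then show "(?E (\<xi> - \<eta>) * h (\<xi> - \<eta>)) * cnj (?E \<xi> * h \<xi>) =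
        ?E \<eta> * (exp (\<i> * complex_of_real (?b \<bullet> \<xi>)) * h (\<xi> - \<eta>) * cnj (h \<xi>))"
      unfolding E by (simp only: mult_ac)
  qed
  \<comment> \<open>The integrand is the transform of g, first modulated by \<eta> and then
    translated by ?b, against the conjugate of h; Parseval returns to the space side.\<close>
  also have "\<dots> = ?E \<eta> * (complex_of_real ?c * (\<integral>x. ?g (x + ?b) * cnj (g x) \<partial>lborel))"
    using parseval[OF has_L2_fourier_translate[OF has_L2_fourier_modulate[OF gh]] gh]
    by (simp only: integral_mult_right_zero)
  finally have eq: "(\<integral>x. exp (\<i> * complex_of_real (x \<bullet> \<eta>)) * ?u x * cnj (?u x) \<partial>lborel) =
      ?E \<eta> * (\<integral>x. ?g (x + ?b) * cnj (g x) \<partial>lborel)"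
    by simp
  \<comment> \<open>The constant \<open>?E \<eta>\<close> is unimodular, and the modulation inside
    ?g disappears once the modulus is taken under the integral.\<close>
  have "cmod (\<integral>x. exp (\<i> * complex_of_real (x \<bullet> \<eta>)) * complex_of_real ((cmod (?u x))\<^sup>2) \<partial>lborel) =
      cmod (\<integral>x. ?g (x + ?b) * cnj (g x) \<partial>lborel)"
    unfolding complex_norm_square mult.assoc[symmetric] eq norm_mult unim by simp
  also have "\<dots> \<le> (\<integral>x. cmod (?g (x + ?b) * cnj (g x)) \<partial>lborel)"
    by (rule integral_norm_bound)
  finally show "cmod (\<integral>x. exp (\<i> * complex_of_real (x \<bullet> \<eta>)) * complex_of_real ((cmod (?u x))\<^sup>2) \<partial>lborel)
        \<le> (\<integral>x. cmod (g (x + ?b)) * cmod (g x) \<partial>lborel)"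
    by (simp add: norm_mult)
qed

text \<open>Up to a small L2 error p, g lives on a ball. Once the shift exceeds the diameter, x and
  x + w never both lie in that ball, so at every point one factor of the product has the modulus of
  the tail. Two Cauchy-Schwarz estimates then give the factor 2 with which k is chosen.\<close>

lemma integral_translate_overlap_tendsto_0:
  fixes g :: "'a::euclidean_space \<Rightarrow> complex"
  assumes g: "square_integrable g" and z: "filterlim z at_infinity F"
  shows "((\<lambda>k. \<integral>x. cmod (g (x + z k)) * cmod (g x) \<partial>lborel) \<longlongrightarrow> 0) F"
proof (rule tendstoI)
  fix e :: real assume e: "0 < e"
  define p where "p k x = indicator (cball 0 (real k)) x * g x - g x" for k :: nat and x
  have "(\<lambda>k. 2 * L2_norm g * L2_norm (p k)) \<longlonglongrightarrow> 0"
    unfolding p_def by (intro tendsto_mult_right_zero L2_norm_truncation_tendsto g)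
  then obtain k where k: "2 * L2_norm g * L2_norm (p k) < e"
    using e by (metis (no_types, lifting) eventually_sequentially order_refl order_tendstoD(2))
  have p: "square_integrable (p k)"
    unfolding p_def by (intro square_integrable_diff square_integrable_truncation g)
  have gz: "square_integrable (\<lambda>x. g (x + w))" and pz: "square_integrable (\<lambda>x. p k (x + w))" for w
    by (intro square_integrable_translate g p)+
  \<comment> \<open>The extra 1 makes the separation strict, and keeps the threshold positive for k
    = 0 as the characterisation of \<open>at_infinity\<close> requires.\<close>
  have "(\<integral>x. cmod (g (x + w)) * cmod (g x) \<partial>lborel) < e" if w: "2 * real k + 1 \<le> norm w" for w
  proof -
    have "(\<integral>x. cmod (g (x + w)) * cmod (g x) \<partial>lborel) \<le>
        (\<integral>x. cmod (p k (x + w)) * cmod (g x) + cmod (g (x + w)) * cmod (p k x) \<partial>lborel)"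
    proof (rule integral_mono)
      fix x
      have "\<not> (norm x \<le> real k \<and> norm (x + w) \<le> real k)"
        using norm_triangle_ineq4[of "x + w" x] w by auto
      then have "cmod (p k x) = cmod (g x) \<or> cmod (p k (x + w)) = cmod (g (x + w))"
        by (auto simp: p_def)
      then show "cmod (g (x + w)) * cmod (g x) \<le>
          cmod (p k (x + w)) * cmod (g x) + cmod (g (x + w)) * cmod (p k x)"
        by auto
    qed (use integrable_cmod_mult_L2[OF gz g] integrable_cmod_mult_L2[OF pz g]
          integrable_cmod_mult_L2[OF gz p] in auto)
    also have "\<dots> = (\<integral>x. cmod (p k (x + w)) * cmod (g x) \<partial>lborel) + (\<integral>x. cmod (g (x + w)) * cmod (p k x) \<partial>lborel)"
      using integrable_cmod_mult_L2[OF pz g] integrable_cmod_mult_L2[OF gz p] by simp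
    also have "\<dots> \<le> L2_norm (p k) * L2_norm g + L2_norm g * L2_norm (p k)"
      using integral_cmod_mult_L2_le[OF pz g, of w] integral_cmod_mult_L2_le[OF gz p, of w]
      unfolding L2_norm_translate by (rule add_mono)
    also have "\<dots> < e"
      using k by (simp add: algebra_simps)
    finally show ?thesis .
  qed
  moreover have "\<forall>\<^sub>F i in F. 2 * real k + 1 \<le> norm (z i)"
    using z unfolding filterlim_at_infinity[OF order_refl] by (auto simp: add_nonneg_pos)
  ultimately show "\<forall>\<^sub>F i in F. dist (\<integral>x. cmod (g (x + z i)) * cmod (g x) \<partial>lborel) 0 < e"
    by (auto elim!: eventually_mono simp: dist_real_def abs_of_nonneg)
qed

section \<open>Almost periodic functions and the invariant mean\<close>

definition character :: "'a::euclidean_space \<Rightarrow> 'a \<Rightarrow> complex" where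
  "character \<xi> x = exp (\<i> * complex_of_real (x \<bullet> \<xi>))"

lemma character_0 [simp]: "character 0 x = 1"
  by (simp add: character_def)

lemma norm_character [simp]: "cmod (character \<xi> x) = 1"
  by (simp add: character_def)

lemma character_diff: "character \<xi> (x - z) = character \<xi> (- z) * character \<xi> x"
  by (simp add: character_def inner_diff_left algebra_simps flip: exp_add)

lemma cnj_character: "cnj (character \<xi> x) = character (- \<xi>) x"
  by (simp add: character_def exp_cnj)

lemma continuous_on_character [continuous_intros]: "continuous_on A (character \<xi>)"
  unfolding character_def by (intro continuous_intros)

section \<open>Trigonometric polynomials\<close>

lemma trig_polynomials_iff:
  "p \<in> trig_polynomials \<longleftrightarrow> (\<exists>\<Xi> c. finite \<Xi> \<and> p = (\<lambda>x. \<Sum>\<xi>\<in>\<Xi>. c \<xi> * character \<xi> x))"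
  by (simp add: trig_polynomials_def character_def)

lemma trig_polynomials_character: "(\<lambda>x. c * character \<xi> x) \<in> trig_polynomials"
  unfolding trig_polynomials_iff by (rule exI[of _ "{\<xi>}"], rule exI[of _ "\<lambda>_. c"]) simp

lemma trig_polynomials_add:
  assumes "p \<in> trig_polynomials" "q \<in> trig_polynomials"
  shows "(\<lambda>x. p x + q x) \<in> trig_polynomials"
proof -
  obtain P c where P: "finite P" "p = (\<lambda>x. \<Sum>\<xi>\<in>P. c \<xi> * character \<xi> x)"
    using assms(1) unfolding trig_polynomials_iff by blast
  obtain Q d where Q: "finite Q" "q = (\<lambda>x. \<Sum>\<xi>\<in>Q. d \<xi> * character \<xi> x)"
    using assms(2) unfolding trig_polynomials_iff by blast
  \<comment> \<open>The frequency sets may overlap, so both coefficient families are extended by 0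
    to the union and added there.\<close>
  define e where "e \<xi> = (if \<xi> \<in> P then c \<xi> else 0) + (if \<xi> \<in> Q then d \<xi> else 0)" for \<xi>
  have "p x = (\<Sum>\<xi>\<in>P \<union> Q. (if \<xi> \<in> P then c \<xi> else 0) * character \<xi> x)" for x
    unfolding P(2) using P(1) Q(1) by (intro sum.mono_neutral_cong_left) auto
  moreover have "q x = (\<Sum>\<xi>\<in>P \<union> Q. (if \<xi> \<in> Q then d \<xi> else 0) * character \<xi> x)" for x
    unfolding Q(2) using P(1) Q(1) by (intro sum.mono_neutral_cong_left) auto
  ultimately have "(\<lambda>x. p x + q x) = (\<lambda>x. \<Sum>\<xi>\<in>P \<union> Q. e \<xi> * character \<xi> x)"
    by (simp add: e_def distrib_right sum.distrib)
  then show ?thesis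
    unfolding trig_polynomials_iff using P(1) Q(1) by (intro exI[of _ "P \<union> Q"] exI[of _ e]) auto
qed

text \<open>Reduces closure properties and limits to the effect on a single character.\<close>

lemma trig_polynomials_induct [consumes 1, case_names zero add]:
  assumes "p \<in> trig_polynomials"
    and "P (\<lambda>x. 0)"
    and "\<And>c \<xi> q. q \<in> trig_polynomials \<Longrightarrow> P q \<Longrightarrow> P (\<lambda>x. c * character \<xi> x + q x)"
  shows "P p"
proof -
  obtain \<Xi> c where "finite \<Xi>" and p: "p = (\<lambda>x. \<Sum>\<xi>\<in>\<Xi>. c \<xi> * character \<xi> x)"
    using assms(1) unfolding trig_polynomials_iff by blast
  from \<open>finite \<Xi>\<close> have "P (\<lambda>x. \<Sum>\<xi>\<in>\<Xi>. c \<xi> * character \<xi> x)"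
  proof (induction \<Xi>)
    case (insert \<xi> \<Xi>)
    have "(\<lambda>x. \<Sum>\<xi>\<in>\<Xi>. c \<xi> * character \<xi> x) \<in> trig_polynomials"
      unfolding trig_polynomials_iff using insert(1) by blast
    from assms(3)[OF this insert(3)] show ?case
      using insert by simp
  qed (use assms(2) in simp)
  then show ?thesis
    by (simp add: p)
qed

lemma trig_polynomials_const: "(\<lambda>x. c) \<in> trig_polynomials"
  using trig_polynomials_character[of c 0] by simp

lemma trig_polynomials_cmult:
  "p \<in> trig_polynomials \<Longrightarrow> (\<lambda>x. c * p x) \<in> trig_polynomials"
proof (induction rule: trig_polynomials_induct)
  case (add d \<xi> q)
  then show ?case
    using trig_polynomials_add[OF trig_polynomials_character[of "c * d" \<xi>] add(2)]
    by (simp add: distrib_left mult.assoc)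
qed (simp add: trig_polynomials_const)

lemma trig_polynomials_cnj:
  "p \<in> trig_polynomials \<Longrightarrow> (\<lambda>x. cnj (p x)) \<in> trig_polynomials"
proof (induction rule: trig_polynomials_induct)
  case (add d \<xi> q)
  then show ?case
    using trig_polynomials_add[OF trig_polynomials_character[of "cnj d" "- \<xi>"] add(2)]
    by (simp add: cnj_character)
qed (simp add: trig_polynomials_const)

lemma trig_polynomials_translate:
  "p \<in> trig_polynomials \<Longrightarrow> (\<lambda>x. p (x - z)) \<in> trig_polynomials"
proof (induction rule: trig_polynomials_induct)
  case (add d \<xi> q)
  then show ?case
    using trig_polynomials_add[OF trig_polynomials_character[of "d * character \<xi> (- z)" \<xi>] add(2)]
    by (simp add: character_diff mult.assoc)
qed (simp add: trig_polynomials_const)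

lemma trig_polynomials_bcontfun: "p \<in> trig_polynomials \<Longrightarrow> p \<in> bcontfun"
proof (induction rule: trig_polynomials_induct)
  case zero
  show ?case by (rule const_bcontfun)
next
  case (add c \<xi> q)
  have "(\<lambda>x. c * character \<xi> x) \<in> bcontfun"
    by (rule bcontfun_normI[where b = "cmod c"]) (auto intro!: continuous_intros simp: norm_mult)
  from plus_cont[OF this add(2)] show ?case .
qed

text \<open>Eliminates the type of bounded continuous functions: uniform approximability by
  trigonometric polynomials already forces continuity, as a uniform limit, and boundedness.\<close>

lemma almost_periodic_iff:
  fixes f :: "'a::euclidean_space \<Rightarrow> complex"
  shows "f \<in> almost_periodic \<longleftrightarrow>
    (\<forall>e>0. \<exists>p\<in>trig_polynomials. \<forall>x. cmod (f x - p x) \<le> e)"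
proof
  assume "f \<in> almost_periodic"
  then obtain G where f: "f = apply_bcontfun G"
    and G: "G \<in> closure {p :: 'a \<Rightarrow>\<^sub>C complex. apply_bcontfun p \<in> trig_polynomials}"
    unfolding almost_periodic_def by blast
  show "\<forall>e>0. \<exists>p\<in>trig_polynomials. \<forall>x. cmod (f x - p x) \<le> e"
  proof (intro allI impI)
    fix e :: real assume "0 < e"
    then obtain p where p: "apply_bcontfun p \<in> trig_polynomials" "dist p G < e"
      using G unfolding closure_approachable by blast
    have "cmod (f x - apply_bcontfun p x) \<le> e" for x
      using dist_fun_lt_imp_dist_val_lt[OF p(2), of x] by (simp add: f dist_norm norm_minus_commute)
    with p(1) show "\<exists>p\<in>trig_polynomials. \<forall>x. cmod (f x - p x) \<le> e"
      by blast
  qed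
next
  assume approx: "\<forall>e>0. \<exists>p\<in>trig_polynomials. \<forall>x. cmod (f x - p x) \<le> e"
  have "\<exists>p\<in>trig_polynomials. \<forall>x. cmod (f x - p x) \<le> inverse (Suc k)" for k
    using approx by simp
  then obtain p where p: "\<And>k. p k \<in> trig_polynomials" and
    fp: "\<And>k x. cmod (f x - p k x) \<le> inverse (Suc k)"
    by metis
  have lim: "uniform_limit UNIV p f sequentially"
  proof (rule uniform_limitI)
    fix e :: real assume "0 < e"
    then have "\<forall>\<^sub>F k in sequentially. inverse (real (Suc k)) < e"
      using LIMSEQ_inverse_real_of_nat order_tendstoD(2) by blast
    then show "\<forall>\<^sub>F k in sequentially. \<forall>x\<in>UNIV. dist (p k x) (f x) < e"
      by eventually_elim (use fp in \<open>auto simp: dist_norm norm_minus_commute intro: le_less_trans\<close>)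
  qed
  have cont: "continuous_on UNIV f"
    using trig_polynomials_bcontfun[OF p]
    by (intro uniform_limit_theorem[OF _ lim]) (auto simp: bcontfun_def)
  \<comment> \<open>The approximant with index 0 has error at most 1, which explains the bound 1 +
    B.\<close>
  obtain B where B: "\<And>x. cmod (p 0 x) \<le> B"
    using trig_polynomials_bcontfun[OF p[of 0]] unfolding bcontfun_def bounded_iff by auto
  have "cmod (f x) \<le> 1 + B" for x
    using norm_triangle_ineq[of "f x - p 0 x" "p 0 x"] fp[of x 0] B[of x] by simp
  then have "f \<in> bcontfun"
    by (rule bcontfun_normI[OF cont])
  then have f: "apply_bcontfun (Bcontfun f) = f"
    by (rule Bcontfun_inverse)
  have "Bcontfun f \<in> closure {p. apply_bcontfun p \<in> trig_polynomials}"
    unfolding closure_approachable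
  proof (intro allI impI)
    fix e :: real assume "0 < e"
    then obtain q where q: "q \<in> trig_polynomials" "\<And>x. cmod (f x - q x) \<le> e / 2"
      using approx half_gt_zero by blast
    have q': "apply_bcontfun (Bcontfun q) = q"
      by (rule Bcontfun_inverse) (rule trig_polynomials_bcontfun[OF q(1)])
    have "dist (Bcontfun q) (Bcontfun f) \<le> e / 2"
      by (rule dist_bound) (use q(2) in \<open>simp add: f q' dist_norm norm_minus_commute\<close>)
    then show "\<exists>y\<in>{p. apply_bcontfun p \<in> trig_polynomials}. dist y (Bcontfun f) < e"
      using q(1) q' \<open>0 < e\<close> by (intro bexI[of _ "Bcontfun q"]) auto
  qed
  then show "f \<in> almost_periodic"
    unfolding almost_periodic_def using f by (metis image_eqI)
qed

lemma almost_periodicE: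
  assumes "f \<in> almost_periodic" "0 < e"
  obtains p where "p \<in> trig_polynomials" "\<And>x. cmod (f x - p x) \<le> e"
  using assms unfolding almost_periodic_iff by blast

lemma trig_polynomials_almost_periodic: "p \<in> trig_polynomials \<Longrightarrow> p \<in> almost_periodic"
  unfolding almost_periodic_iff by (auto intro!: bexI[of _ p])

lemma almost_periodic_add:
  assumes "f \<in> almost_periodic" "g \<in> almost_periodic"
  shows "(\<lambda>x. f x + g x) \<in> almost_periodic"
  unfolding almost_periodic_iff
proof (intro allI impI)
  fix e :: real assume "0 < e"
  then obtain p q where p: "p \<in> trig_polynomials" "\<And>x. cmod (f x - p x) \<le> e / 2"
    and q: "q \<in> trig_polynomials" "\<And>x. cmod (g x - q x) \<le> e / 2"
    using almost_periodicE[OF assms(1), of "e / 2"] almost_periodicE[OF assms(2), of "e / 2"]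
    by (metis half_gt_zero)
  have "cmod (f x + g x - (p x + q x)) \<le> e" for x
    using norm_triangle_ineq[of "f x - p x" "g x - q x"] p(2)[of x] q(2)[of x]
    by (simp add: algebra_simps)
  then show "\<exists>p\<in>trig_polynomials. \<forall>x. cmod (f x + g x - p x) \<le> e"
    by (intro bexI[OF _ trig_polynomials_add[OF p(1) q(1)]] allI)
qed

lemma almost_periodic_cmult:
  assumes "f \<in> almost_periodic"
  shows "(\<lambda>x. c * f x) \<in> almost_periodic"
  unfolding almost_periodic_iff
proof (intro allI impI)
  fix e :: real assume e: "0 < e"
  then obtain p where p: "p \<in> trig_polynomials" "\<And>x. cmod (f x - p x) \<le> e / (cmod c + 1)"
    using almost_periodicE[OF assms, of "e / (cmod c + 1)"] by (metis add_nonneg_pos divide_pos_pos norm_ge_zero zero_less_one)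
  have "cmod (c * f x - c * p x) \<le> e" for x
  proof -
    have "cmod (c * f x - c * p x) \<le> cmod c * (e / (cmod c + 1))"
      unfolding right_diff_distrib[symmetric] norm_mult by (intro mult_left_mono p) simp
    also have "\<dots> \<le> e"
    proof -
      have "cmod c * e \<le> e * (cmod c + 1)"
        using e by (simp add: algebra_simps)
      then show ?thesis
        by (simp add: pos_divide_le_eq add_nonneg_pos)
    qed
    finally show ?thesis .
  qed
  then show "\<exists>p\<in>trig_polynomials. \<forall>x. cmod (c * f x - p x) \<le> e"
    by (intro bexI[OF _ trig_polynomials_cmult[OF p(1)]] allI)
qed

lemma almost_periodic_cnj:
  assumes "f \<in> almost_periodic"
  shows "(\<lambda>x. cnj (f x)) \<in> almost_periodic"
  unfolding almost_periodic_iff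
proof (intro allI impI)
  fix e :: real assume "0 < e"
  then obtain p where p: "p \<in> trig_polynomials" "\<And>x. cmod (f x - p x) \<le> e"
    using almost_periodicE[OF assms] by blast
  have "cmod (cnj (f x) - cnj (p x)) \<le> e" for x
    using p(2)[of x] by (metis complex_cnj_diff complex_mod_cnj)
  then show "\<exists>p\<in>trig_polynomials. \<forall>x. cmod (cnj (f x) - p x) \<le> e"
    by (intro bexI[OF _ trig_polynomials_cnj[OF p(1)]] allI)
qed

lemma almost_periodic_translate:
  assumes "f \<in> almost_periodic"
  shows "(\<lambda>x. f (x - z)) \<in> almost_periodic"
  unfolding almost_periodic_iff
proof (intro allI impI)
  fix e :: real assume "0 < e"
  then obtain p where p: "p \<in> trig_polynomials" "\<And>x. cmod (f x - p x) \<le> e"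
    using almost_periodicE[OF assms] by blast
  then show "\<exists>p\<in>trig_polynomials. \<forall>x. cmod (f (x - z) - p x) \<le> e"
    by (intro bexI[OF _ trig_polynomials_translate[OF p(1), of z]]) auto
qed

lemma almost_periodic_const: "(\<lambda>x. c) \<in> almost_periodic"
  by (intro trig_polynomials_almost_periodic trig_polynomials_const)

lemma almost_periodic_diff:
  assumes "f \<in> almost_periodic" "g \<in> almost_periodic"
  shows "(\<lambda>x. f x - g x) \<in> almost_periodic"
  using almost_periodic_add[OF assms(1) almost_periodic_cmult[OF assms(2), of "-1"]] by simp

lemma almost_periodic_bcontfun: "f \<in> almost_periodic \<Longrightarrow> f \<in> bcontfun"
  by (auto simp: almost_periodic_def intro: apply_bcontfun)

section \<open>Boundedness and uniqueness of invariant means\<close>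

lemma is_invariant_meanD:
  assumes "is_invariant_mean m"
  shows "f \<in> almost_periodic \<Longrightarrow> g \<in> almost_periodic \<Longrightarrow> m (\<lambda>x. f x + g x) = m f + m g"
    and "f \<in> almost_periodic \<Longrightarrow> m (\<lambda>x. c * f x) = c * m f"
    and "f \<in> almost_periodic \<Longrightarrow> (\<And>x. f x \<in> \<real>\<^sub>\<ge>\<^sub>0) \<Longrightarrow> m f \<in> \<real>\<^sub>\<ge>\<^sub>0"
    and "m (\<lambda>x. 1) = 1"
    and "f \<in> almost_periodic \<Longrightarrow> m (\<lambda>x. f (x - z)) = m f"
  using assms unfolding is_invariant_mean_def by auto

lemma is_invariant_mean_diff:
  assumes "is_invariant_mean m" "f \<in> almost_periodic" "g \<in> almost_periodic"
  shows "m (\<lambda>x. f x - g x) = m f - m g"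
  using is_invariant_meanD(1)[OF assms(1,2) almost_periodic_cmult[OF assms(3), of "-1"]]
    is_invariant_meanD(2)[OF assms(1,3), of "-1"] by simp

lemma is_invariant_mean_const:
  assumes "is_invariant_mean m"
  shows "m (\<lambda>x. c) = c"
  using is_invariant_meanD(2)[OF assms almost_periodic_const[of 1], of c] is_invariant_meanD(4)[OF assms]
  by simp

text \<open>Positivity is applied to e - f and to e + f. Membership of both values in the
  nonnegative reals shows at once that m f is real and that it lies between -e and e.\<close>

lemma is_invariant_mean_real_bound:
  assumes m: "is_invariant_mean m" and f: "f \<in> almost_periodic"
    and real: "\<And>x. f x \<in> \<real>" and le: "\<And>x. cmod (f x) \<le> e"
  shows "cmod (m f) \<le> e"
proof -
  have f': "Im (f x) = 0" "\<bar>Re (f x)\<bar> \<le> e" for x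
    using real[of x] le[of x] by (auto simp: complex_is_Real_iff cmod_def)
  have "m (\<lambda>x. complex_of_real e - f x) \<in> \<real>\<^sub>\<ge>\<^sub>0"
    by (intro is_invariant_meanD(3)[OF m] almost_periodic_diff almost_periodic_const f)
      (use f' in \<open>auto simp: complex_nonneg_Reals_iff abs_le_iff\<close>)
  moreover have "m (\<lambda>x. complex_of_real e + f x) \<in> \<real>\<^sub>\<ge>\<^sub>0"
  proof (intro is_invariant_meanD(3)[OF m] almost_periodic_add almost_periodic_const f)
    fix x
    show "complex_of_real e + f x \<in> \<real>\<^sub>\<ge>\<^sub>0"
      using f'[of x] by (auto simp: complex_nonneg_Reals_iff abs_le_iff)
  qed
  ultimately have "complex_of_real e - m f \<in> \<real>\<^sub>\<ge>\<^sub>0" "complex_of_real e + m f \<in> \<real>\<^sub>\<ge>\<^sub>0"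
    by (simp_all add: is_invariant_mean_diff[OF m almost_periodic_const f]
        is_invariant_meanD(1)[OF m almost_periodic_const f] is_invariant_mean_const[OF m])
  then have "Im (m f) = 0" "\<bar>Re (m f)\<bar> \<le> e"
    by (auto simp: complex_nonneg_Reals_iff)
  then show ?thesis
    by (simp add: cmod_def)
qed

text \<open>Treating real and imaginary parts separately costs a factor 2, harmless for the
  continuity of m in the supremum norm.\<close>

lemma is_invariant_mean_bound:
  assumes m: "is_invariant_mean m" and f: "f \<in> almost_periodic" and le: "\<And>x. cmod (f x) \<le> e"
  shows "cmod (m f) \<le> 2 * e"
proof -
  let ?r = "\<lambda>x. (1 / 2) * (f x + cnj (f x))" and ?i = "\<lambda>x. (- \<i> / 2) * (f x - cnj (f x))"
  have ap: "?r \<in> almost_periodic" "?i \<in> almost_periodic"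
    by (intro almost_periodic_cmult almost_periodic_add almost_periodic_diff almost_periodic_cnj f)+
  have r: "?r x = complex_of_real (Re (f x))" and i: "?i x = complex_of_real (Im (f x))" for x
    by (simp_all add: complex_eq_iff)
  have "cmod (m ?r) \<le> e"
    by (rule is_invariant_mean_real_bound[OF m ap(1)]) (simp only: r Reals_of_real,
        use abs_Re_le_cmod le in \<open>simp only: r norm_of_real, meson order_trans\<close>)
  moreover have "cmod (m ?i) \<le> e"
    by (rule is_invariant_mean_real_bound[OF m ap(2)]) (simp only: i Reals_of_real,
        use abs_Im_le_cmod le in \<open>simp only: i norm_of_real, meson order_trans\<close>)
  moreover have "m f = m ?r + \<i> * m ?i"
  proof -
    have "f = (\<lambda>x. ?r x + \<i> * ?i x)"
      by (rule ext) (simp only: r i complex_eq_iff, simp)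
    then show ?thesis
      using is_invariant_meanD(1)[OF m ap(1) almost_periodic_cmult[OF ap(2), of \<i>]]
        is_invariant_meanD(2)[OF m ap(2), of \<i>] by simp
  qed
  ultimately show ?thesis
    using norm_triangle_ineq[of "m ?r" "\<i> * m ?i"] by (simp add: norm_mult)
qed

text \<open>The shift z satisfies z \<bullet> \<xi> = pi, half a period, so it changes the sign of
  the character; invariance then gives m = -m.\<close>

lemma is_invariant_mean_character:
  assumes m: "is_invariant_mean m" and "\<xi> \<noteq> 0"
  shows "m (character \<xi>) = 0"
proof -
  define z where "z = (pi / (norm \<xi>)\<^sup>2) *\<^sub>R \<xi>"
  have ap: "character \<xi> \<in> almost_periodic"
    using trig_polynomials_character[of 1 \<xi>] by (intro trig_polynomials_almost_periodic) simp
  have "z \<bullet> \<xi> = pi"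
    using \<open>\<xi> \<noteq> 0\<close> by (simp add: z_def power2_norm_eq_inner)
  then have "character \<xi> (- z) = -1"
    by (simp add: character_def exp_minus mult.commute[of \<i>])
  then have "(\<lambda>x. character \<xi> (x - z)) = (\<lambda>x. -1 * character \<xi> x)"
    by (simp add: character_diff)
  then have "m (character \<xi>) = -1 * m (character \<xi>)"
    using is_invariant_meanD(5)[OF m ap, of z] is_invariant_meanD(2)[OF m ap, of "-1"] by simp
  then show ?thesis
    by simp
qed

text \<open>Characters determine the mean on trigonometric polynomials by linearity, and boundedness
  carries the agreement to uniform limits.\<close>

lemma is_invariant_mean_unique:
  assumes m: "is_invariant_mean m" and m': "is_invariant_mean m'" and f: "f \<in> almost_periodic"
  shows "m f = m' f"
proof -
  have trig: "m p = m' p" if "p \<in> trig_polynomials" for p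
    using that
  proof (induction rule: trig_polynomials_induct)
    case zero
    show ?case
      using is_invariant_mean_const[OF m] is_invariant_mean_const[OF m'] by simp
  next
    case (add c \<xi> q)
    have ap: "character \<xi> \<in> almost_periodic" "q \<in> almost_periodic"
      using trig_polynomials_character[of 1 \<xi>] add(1) by (auto intro: trig_polynomials_almost_periodic)
    have "m (character \<xi>) = m' (character \<xi>)"
      using is_invariant_mean_character[OF m] is_invariant_mean_character[OF m']
        is_invariant_meanD(4)[OF m] is_invariant_meanD(4)[OF m']
      by (cases "\<xi> = 0") (simp_all add: character_0[abs_def])
    then show ?case
      using is_invariant_meanD(1)[OF m almost_periodic_cmult[OF ap(1)] ap(2)]
        is_invariant_meanD(1)[OF m' almost_periodic_cmult[OF ap(1)] ap(2)]
        is_invariant_meanD(2)[OF m ap(1)] is_invariant_meanD(2)[OF m' ap(1)] add(2)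
      by simp
  qed
  have "cmod (m f - m' f) \<le> 0 + e" if "0 < e" for e
  proof -
    \<comment> \<open>With e / 4 each of the two functionals contributes at most 2 * (e /
      4).\<close>
    obtain p where p: "p \<in> trig_polynomials" and le: "\<And>x. cmod (f x - p x) \<le> e / 4"
      using almost_periodicE[OF f, of "e / 4"] \<open>0 < e\<close> by auto
    have pa: "p \<in> almost_periodic"
      by (rule trig_polynomials_almost_periodic[OF p])
    have "m f - m' f = m (\<lambda>x. f x - p x) - m' (\<lambda>x. f x - p x)"
      using trig[OF p] is_invariant_mean_diff[OF m f pa] is_invariant_mean_diff[OF m' f pa] by simp
    then show ?thesis
      using norm_triangle_ineq4[of "m (\<lambda>x. f x - p x)" "m' (\<lambda>x. f x - p x)"]
        is_invariant_mean_bound[OF m almost_periodic_diff[OF f pa] le]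
        is_invariant_mean_bound[OF m' almost_periodic_diff[OF f pa] le] by simp
  qed
  then have "cmod (m f - m' f) \<le> 0"
    by (rule field_le_epsilon)
  then show ?thesis
    by simp
qed

text \<open>Evaluates the definite description from any given mean: its restriction is the
  extensional representative, and uniqueness excludes every other.\<close>

lemma invariant_mean_eq:
  fixes m :: "('a::euclidean_space \<Rightarrow> complex) \<Rightarrow> complex"
  assumes m: "is_invariant_mean m" and f: "f \<in> almost_periodic"
  shows "invariant_mean f = m f"
proof -
  let ?m = "restrict m almost_periodic"
  have m': "is_invariant_mean ?m"
    unfolding is_invariant_mean_def
    using is_invariant_meanD[OF m]
    by (auto simp: almost_periodic_add almost_periodic_cmult almost_periodic_translate almost_periodic_const)
  have "invariant_mean = ?m"
    unfolding invariant_mean_def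
  proof (rule the_equality)
    show "?m \<in> extensional almost_periodic \<and> is_invariant_mean ?m"
      using m' by simp
    fix m1 :: "('a \<Rightarrow> complex) \<Rightarrow> complex" assume "m1 \<in> extensional almost_periodic \<and> is_invariant_mean m1"
    then show "m1 = ?m"
      using is_invariant_mean_unique[OF _ m'] by (intro extensionalityI[of _ almost_periodic]) auto
  qed
  then show ?thesis
    using f by (metis restrict_apply')
qed

text \<open>An interchange of limits. The limits of two approximants differ by at most the sum of
  their errors, hence form a Cauchy sequence, and completeness provides the value of the
  limit.\<close>

lemma tendsto_exists_uniform_approx:
  fixes I :: "'b \<Rightarrow> 'c::complete_space"
  assumes F: "F \<noteq> bot"
    and approx: "\<And>e. 0 < e \<Longrightarrow> \<exists>J L. (J \<longlongrightarrow> L) F \<and> (\<forall>\<^sub>F i in F. dist (I i) (J i) \<le> e)"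
  shows "\<exists>L. (I \<longlongrightarrow> L) F"
proof -
  have "\<exists>J L. (J \<longlongrightarrow> L) F \<and> (\<forall>\<^sub>F i in F. dist (I i) (J i) \<le> inverse (real (Suc n)))" for n
    by (rule approx) simp
  then obtain J L where JL: "\<And>n. (J n \<longlongrightarrow> L n) F"
    and IJ: "\<And>n. \<forall>\<^sub>F i in F. dist (I i) (J n i) \<le> inverse (real (Suc n))"
    by metis
  have LL: "dist (L n) (L k) \<le> inverse (real (Suc n)) + inverse (real (Suc k))" for n k
  proof (rule tendsto_upperbound[OF tendsto_dist[OF JL JL] _ F])
    show "\<forall>\<^sub>F i in F. dist (J n i) (J k i) \<le> inverse (real (Suc n)) + inverse (real (Suc k))"
      using IJ[of n] IJ[of k]
    proof eventually_elim
      case (elim i)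
      then show ?case
        using dist_triangle[of "J n i" "J k i" "I i"] by (simp add: dist_commute)
    qed
  qed
  have small: "\<exists>N. \<forall>n\<ge>N. inverse (real (Suc n)) < e" if "0 < e" for e
    using order_tendstoD(2)[OF LIMSEQ_inverse_real_of_nat that] by (simp add: eventually_sequentially)
  have "Cauchy L"
  proof (rule metric_CauchyI)
    fix e :: real assume "0 < e"
    then obtain N where N: "\<And>n. n \<ge> N \<Longrightarrow> inverse (real (Suc n)) < e / 2"
      using small[of "e / 2"] by auto
    have "dist (L n) (L k) < e" if "n \<ge> N" "k \<ge> N" for n k
      using LL[of n k] N[OF that(1)] N[OF that(2)] by simp
    then show "\<exists>M. \<forall>m\<ge>M. \<forall>n\<ge>M. dist (L m) (L n) < e"
      by blast
  qed
  then obtain l where l: "L \<longlonglongrightarrow> l"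
    using Cauchy_convergent convergent_def by blast
  have "(I \<longlongrightarrow> l) F"
  proof (rule tendstoI)
    fix e :: real assume "0 < e"
    then obtain N where N: "\<And>n. n \<ge> N \<Longrightarrow> inverse (real (Suc n)) < e / 3"
      using small[of "e / 3"] by auto
    obtain M where M: "\<And>n. n \<ge> M \<Longrightarrow> dist (L n) l < e / 3"
      using metric_LIMSEQ_D[OF l, of "e / 3"] \<open>0 < e\<close> by auto
    define n where "n = max N M"
    have "\<forall>\<^sub>F i in F. dist (J n i) (L n) < e / 3"
      by (intro tendstoD[OF JL]) (use \<open>0 < e\<close> in simp)
    then show "\<forall>\<^sub>F i in F. dist (I i) l < e"
      using IJ[of n]
    proof eventually_elim
      case (elim i)
      then show ?case
        using dist_triangle[of "I i" l "J n i"] dist_triangle[of "J n i" l "L n"] N[of n] M[of n]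
        by (simp add: n_def)
    qed
  qed
  then show ?thesis ..
qed

text \<open>The limit functional is itself an invariant mean: translation multiplies a character by a
  constant, and all nontrivial characters have limit \<open>0\<close>. Hence existence of the mean comes for free.\<close>

theorem integral_tendsto_invariant_mean:
  fixes \<mu> :: "'b \<Rightarrow> 'a::euclidean_space measure"
  assumes F: "F \<noteq> bot"
    and \<mu>: "\<forall>\<^sub>F i in F. prob_space (\<mu> i) \<and> sets (\<mu> i) = sets borel"
    and char: "\<And>\<xi>. \<xi> \<noteq> 0 \<Longrightarrow> ((\<lambda>i. \<integral>x. character \<xi> x \<partial>\<mu> i) \<longlongrightarrow> 0) F"
    and f: "f \<in> almost_periodic"
  shows "((\<lambda>i. \<integral>x. f x \<partial>\<mu> i) \<longlongrightarrow> invariant_mean f) F"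
proof -
  let ?P = "\<lambda>i. prob_space (\<mu> i) \<and> sets (\<mu> i) = sets borel"
  have int: "integrable (\<mu> i) g" if "?P i" "g \<in> almost_periodic" for g i
  proof -
    interpret prob_space "\<mu> i" using that by simp
    have "continuous_on UNIV g" "bounded (range g)"
      using almost_periodic_bcontfun[OF that(2)] by (auto simp: bcontfun_def)
    then have "g \<in> borel_measurable (\<mu> i)"
      using that(1) borel_measurable_continuous_onI by (simp cong: measurable_cong_sets)
    moreover obtain B where "\<And>x. cmod (g x) \<le> B"
      using \<open>bounded (range g)\<close> by (auto simp: bounded_iff)
    ultimately show ?thesis
      by (intro integrable_const_bound[of _ B]) auto
  qed
  have const: "(\<integral>x. c \<partial>\<mu> i) = c" if "?P i" for c :: complex and i
  proof -
    interpret prob_space "\<mu> i" using that by simp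
    show ?thesis by (simp add: prob_space)
  qed
  have close: "cmod ((\<integral>x. g x \<partial>\<mu> i) - (\<integral>x. h x \<partial>\<mu> i)) \<le> e"
    if i: "?P i" and g: "g \<in> almost_periodic" and h: "h \<in> almost_periodic" and le: "\<And>x. cmod (g x - h x) \<le> e"
    for g h i e
  proof -
    interpret prob_space "\<mu> i" using i by simp
    have "cmod ((\<integral>x. g x \<partial>\<mu> i) - (\<integral>x. h x \<partial>\<mu> i)) = cmod (\<integral>x. g x - h x \<partial>\<mu> i)"
      using int[OF i g] int[OF i h] by simp
    also have "\<dots> \<le> (\<integral>x. cmod (g x - h x) \<partial>\<mu> i)"
      by (rule integral_norm_bound)
    also have "\<dots> \<le> (\<integral>x. e \<partial>\<mu> i)"
      using int[OF i g] int[OF i h] le by (intro integral_mono) auto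
    finally show ?thesis
      by (simp add: prob_space)
  qed
  have ap_char: "character \<xi> \<in> almost_periodic" for \<xi> :: 'a
    using trig_polynomials_character[of 1 \<xi>] by (intro trig_polynomials_almost_periodic) simp
  have char_lim: "((\<lambda>i. \<integral>x. character \<xi> x \<partial>\<mu> i) \<longlongrightarrow> (if \<xi> = 0 then 1 else 0)) F" for \<xi>
    using \<mu> char[of \<xi>] const[of _ 1] by (auto intro!: tendsto_eventually elim!: eventually_mono)
  have add_lim: "((\<lambda>i. \<integral>x. c * character \<xi> x + q x \<partial>\<mu> i) \<longlongrightarrow> c * (if \<xi> = 0 then 1 else 0) + L) F"
    if q: "q \<in> trig_polynomials" and L: "((\<lambda>i. \<integral>x. q x \<partial>\<mu> i) \<longlongrightarrow> L) F" for c \<xi> q L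
  proof (rule Lim_transform_eventually)
    show "((\<lambda>i. c * (\<integral>x. character \<xi> x \<partial>\<mu> i) + (\<integral>x. q x \<partial>\<mu> i)) \<longlongrightarrow> c * (if \<xi> = 0 then 1 else 0) + L) F"
      by (intro tendsto_intros char_lim L)
    show "\<forall>\<^sub>F i in F. c * (\<integral>x. character \<xi> x \<partial>\<mu> i) + (\<integral>x. q x \<partial>\<mu> i) = (\<integral>x. c * character \<xi> x + q x \<partial>\<mu> i)"
      using \<mu>
    proof eventually_elim
      case (elim i)
      then show ?case
        using int[OF elim ap_char] int[OF elim trig_polynomials_almost_periodic[OF q]] by simp
    qed
  qed
  \<comment> \<open>Asking for one common limit of p and all its translates builds translation
    invariance into the induction.\<close>
  have trig_lim: "\<exists>L. ((\<lambda>i. \<integral>x. p x \<partial>\<mu> i) \<longlongrightarrow> L) F \<and> (\<forall>z. ((\<lambda>i. \<integral>x. p (x - z) \<partial>\<mu> i) \<longlongrightarrow> L) F)"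
    if "p \<in> trig_polynomials" for p
    using that
  proof (induction rule: trig_polynomials_induct)
    case zero
    show ?case by (auto intro!: exI[of _ 0])
  next
    case (add c \<xi> q)
    then obtain L where L: "((\<lambda>i. \<integral>x. q x \<partial>\<mu> i) \<longlongrightarrow> L) F" "\<And>z. ((\<lambda>i. \<integral>x. q (x - z) \<partial>\<mu> i) \<longlongrightarrow> L) F"
      by blast
    \<comment> \<open>Translation multiplies the coefficient by
      \<open>character \<xi> (- z)\<close>. This factor is 1 for \<xi> = 0 and meets a zero limit
      otherwise.\<close>
    have "((\<lambda>i. \<integral>x. c * character \<xi> (x - z) + q (x - z) \<partial>\<mu> i) \<longlongrightarrow> c * (if \<xi> = 0 then 1 else 0) + L) F" for z
      using add_lim[OF trig_polynomials_translate[OF add(1)] L(2), of "c * character \<xi> (- z)" \<xi> z]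
      by (cases "\<xi> = 0") (simp_all add: character_diff mult.assoc)
    with add_lim[OF add(1) L(1)] show ?case
      by blast
  qed
  have "\<exists>L. ((\<lambda>i. \<integral>x. g x \<partial>\<mu> i) \<longlongrightarrow> L) F" if g: "g \<in> almost_periodic" for g
  proof (rule tendsto_exists_uniform_approx[OF F])
    fix e :: real assume "0 < e"
    with g obtain p where p: "p \<in> trig_polynomials" "\<And>x. cmod (g x - p x) \<le> e"
      by (rule almost_periodicE) blast
    obtain L where "((\<lambda>i. \<integral>x. p x \<partial>\<mu> i) \<longlongrightarrow> L) F"
      using trig_lim[OF p(1)] by blast
    moreover have "\<forall>\<^sub>F i in F. dist (\<integral>x. g x \<partial>\<mu> i) (\<integral>x. p x \<partial>\<mu> i) \<le> e"
      using \<mu> unfolding dist_norm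
      by eventually_elim (rule close[OF _ g trig_polynomials_almost_periodic[OF p(1)] p(2)])
    ultimately show "\<exists>J L. (J \<longlongrightarrow> L) F \<and> (\<forall>\<^sub>F i in F. dist (\<integral>x. g x \<partial>\<mu> i) (J i) \<le> e)"
      by blast
  qed
  \<comment> \<open>M is specified only on almost periodic arguments, the only ones that
    \<open>is_invariant_mean\<close> inspects.\<close>
  then obtain M where M: "\<And>g. g \<in> almost_periodic \<Longrightarrow> ((\<lambda>i. \<integral>x. g x \<partial>\<mu> i) \<longlongrightarrow> M g) F"
    by metis
  have M_eq: "M g = L" if "g \<in> almost_periodic" "((\<lambda>i. \<integral>x. g x \<partial>\<mu> i) \<longlongrightarrow> L) F" for g L
    using tendsto_unique[OF F M[OF that(1)] that(2)] .
  have M_close: "cmod (M g - M h) \<le> e"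
    if g: "g \<in> almost_periodic" and h: "h \<in> almost_periodic" and le: "\<And>x. cmod (g x - h x) \<le> e" for g h e
  proof (rule tendsto_upperbound[OF tendsto_norm[OF tendsto_diff[OF M[OF g] M[OF h]]] _ F])
    show "\<forall>\<^sub>F i in F. cmod ((\<integral>x. g x \<partial>\<mu> i) - (\<integral>x. h x \<partial>\<mu> i)) \<le> e"
      using \<mu> by eventually_elim (rule close[OF _ g h le])
  qed
  have "is_invariant_mean M"
    unfolding is_invariant_mean_def
  proof (intro conjI ballI allI impI)
    fix g h :: "'a \<Rightarrow> complex" assume gh: "g \<in> almost_periodic" "h \<in> almost_periodic"
    show "M (\<lambda>x. g x + h x) = M g + M h"
    proof (rule M_eq[OF almost_periodic_add[OF gh]], rule Lim_transform_eventually)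
      show "((\<lambda>i. (\<integral>x. g x \<partial>\<mu> i) + (\<integral>x. h x \<partial>\<mu> i)) \<longlongrightarrow> M g + M h) F"
        by (intro tendsto_add M gh)
      show "\<forall>\<^sub>F i in F. (\<integral>x. g x \<partial>\<mu> i) + (\<integral>x. h x \<partial>\<mu> i) = (\<integral>x. g x + h x \<partial>\<mu> i)"
        using \<mu> by eventually_elim (simp add: int gh)
    qed
  next
    fix c and g :: "'a \<Rightarrow> complex" assume g: "g \<in> almost_periodic"
    show "M (\<lambda>x. c * g x) = c * M g"
      using tendsto_mult_left[OF M[OF g], of c] by (intro M_eq almost_periodic_cmult g) simp
  next
    fix g :: "'a \<Rightarrow> complex" assume g: "g \<in> almost_periodic" and nn: "\<forall>x. g x \<in> \<real>\<^sub>\<ge>\<^sub>0"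
    have g': "g x = complex_of_real (Re (g x))" "0 \<le> Re (g x)" for x
      using nn by (auto simp: complex_nonneg_Reals_iff complex_eq_iff)
    have "(\<integral>x. g x \<partial>\<mu> i) = complex_of_real (\<integral>x. Re (g x) \<partial>\<mu> i)" for i
      by (subst g'(1)) (rule integral_complex_of_real)
    moreover have "0 \<le> (\<integral>x. Re (g x) \<partial>\<mu> i)" for i
      using g'(2) by simp
    \<comment> \<open>The nonnegative reals are closed in the complex plane, so positivity of the
      integrals survives the limit.\<close>
    ultimately have "\<forall>\<^sub>F i in F. (\<integral>x. g x \<partial>\<mu> i) \<in> \<real>\<^sub>\<ge>\<^sub>0"
      by simp
    from Lim_in_closed_set[OF closed_nonneg_Reals_complex this F M[OF g]]
    show "M g \<in> \<real>\<^sub>\<ge>\<^sub>0" .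
  next
    show "M (\<lambda>x. 1) = 1"
      using char_lim[of 0] by (intro M_eq almost_periodic_const) simp
  next
    fix g :: "'a \<Rightarrow> complex" and z assume g: "g \<in> almost_periodic"
    \<comment> \<open>Invariance is exact for trigonometric polynomials; g and its translate are
      approximated by p and its translate with the same error.\<close>
    have "cmod (M (\<lambda>x. g (x - z)) - M g) \<le> 0 + e" if "0 < e" for e
    proof -
      have "0 < e / 2" using that by simp
      with g obtain p where p: "p \<in> trig_polynomials" and le: "\<And>x. cmod (g x - p x) \<le> e / 2"
        by (rule almost_periodicE) blast
      note ap = trig_polynomials_almost_periodic
      obtain L where L: "((\<lambda>i. \<integral>x. p x \<partial>\<mu> i) \<longlongrightarrow> L) F" "((\<lambda>i. \<integral>x. p (x - z) \<partial>\<mu> i) \<longlongrightarrow> L) F"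
        using trig_lim[OF p] by blast
      have "M (\<lambda>x. p (x - z)) = M p"
        using M_eq[OF ap[OF p] L(1)] M_eq[OF ap[OF trig_polynomials_translate[OF p]] L(2)] by simp
      moreover have "cmod (M (\<lambda>x. g (x - z)) - M (\<lambda>x. p (x - z))) \<le> e / 2"
        by (intro M_close almost_periodic_translate g ap p le)
      moreover have "cmod (M g - M p) \<le> e / 2"
        by (intro M_close g ap p le)
      ultimately show ?thesis
        using norm_triangle_ineq4[of "M (\<lambda>x. g (x - z)) - M p" "M g - M p"] by simp
    qed
    then have "cmod (M (\<lambda>x. g (x - z)) - M g) \<le> 0"
      by (rule field_le_epsilon)
    then show "M (\<lambda>x. g (x - z)) = M g"
      by simp
  qed
  from invariant_mean_eq[OF this f] M[OF f] show ?thesis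
    by simp
qed

section \<open>The limit of the Schroedinger measures\<close>

text \<open>Brings the initial value into the affine form required by the change of variables; the
  prefactor \<epsilon>^(-n/2) is the L2 normalisation.\<close>

lemma sqrt_rescaled:
  fixes \<rho> :: "'a::euclidean_space \<Rightarrow> real"
  assumes "0 < \<epsilon>"
  shows "complex_of_real (sqrt (rescaled \<epsilon> \<rho> (y - a))) =
    complex_of_real (1 / sqrt (\<epsilon> ^ DIM('a))) *
      complex_of_real (sqrt (\<rho> ((- (1 / \<epsilon>)) *\<^sub>R a + (1 / \<epsilon>) *\<^sub>R y)))"
proof -
  have "(y - a) /\<^sub>R \<epsilon> = (- (1 / \<epsilon>)) *\<^sub>R a + (1 / \<epsilon>) *\<^sub>R y"
    by (simp add: scaleR_diff_right inverse_eq_divide)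
  then show ?thesis
    by (simp add: rescaled_def real_sqrt_divide)
qed

text \<open>Substituting x -> a + \<epsilon> x cancels the prefactors against the Jacobian, so the
  dilation is isometric. A fixed translation b is measured in units of \<epsilon> and becomes b /
  \<epsilon>, which is why overlaps disappear in the limit.\<close>

lemma
  fixes \<psi> :: "'a::euclidean_space \<Rightarrow> complex" and a :: 'a and \<epsilon> :: real
  assumes \<epsilon>: "0 < \<epsilon>" and \<psi>: "integrable lborel \<psi>" "square_integrable \<psi>"
  defines "g \<equiv> \<lambda>y. complex_of_real (1 / sqrt (\<epsilon> ^ DIM('a))) * \<psi> ((- (1 / \<epsilon>)) *\<^sub>R a + (1 / \<epsilon>) *\<^sub>R y)"
  shows integrable_L2_dilation: "integrable lborel g"
    and square_integrable_L2_dilation: "square_integrable g"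
    and integral_L2_dilation:
      "(\<integral>x. cmod (g (x + b)) * cmod (g x) \<partial>lborel) = (\<integral>x. cmod (\<psi> (x + b /\<^sub>R \<epsilon>)) * cmod (\<psi> x) \<partial>lborel)"
    and L2_norm_L2_dilation: "L2_norm g = L2_norm \<psi>"
proof -
  note [measurable] = square_integrable_measurable[OF \<psi>(2)]
  have \<epsilon>': "1 / \<epsilon> \<noteq> 0" using \<epsilon> by simp
  show "integrable lborel g"
    unfolding g_def using \<psi>(1)
    by (intro Bochner_Integration.integrable_mult_right impI)
      (simp only: lborel_integrable_affine_iff[OF \<epsilon>', of \<psi>])
  have "square_integrable (\<lambda>y. \<psi> ((- (1 / \<epsilon>)) *\<^sub>R a + (1 / \<epsilon>) *\<^sub>R y))"
    using square_integrable_integrable[OF \<psi>(2)]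
      lborel_integrable_affine_iff[OF \<epsilon>', of "\<lambda>x. (cmod (\<psi> x))\<^sup>2" "(- (1 / \<epsilon>)) *\<^sub>R a"]
    by (simp add: square_integrable_iff)
  then show "square_integrable g"
    unfolding g_def by (rule square_integrable_cmult)
  have shift: "g (a + \<epsilon> *\<^sub>R x + b) = complex_of_real (1 / sqrt (\<epsilon> ^ DIM('a))) * \<psi> (x + b /\<^sub>R \<epsilon>)" for x b
  proof -
    have "(- (1 / \<epsilon>)) *\<^sub>R a + (1 / \<epsilon>) *\<^sub>R (a + \<epsilon> *\<^sub>R x + b) = x + b /\<^sub>R \<epsilon>"
      using \<epsilon> by (simp add: scaleR_add_right inverse_eq_divide)
    then show ?thesis
      by (simp only: g_def)
  qed
  have eq: "(\<integral>x. cmod (g (x + b)) * cmod (g x) \<partial>lborel) =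
      (\<integral>x. cmod (\<psi> (x + b /\<^sub>R \<epsilon>)) * cmod (\<psi> x) \<partial>lborel)" for b
  proof -
    have c: "cmod (complex_of_real (1 / sqrt (\<epsilon> ^ DIM('a)))) = 1 / sqrt (\<epsilon> ^ DIM('a))"
      unfolding norm_of_real using \<epsilon> by simp
    have "(\<integral>x. cmod (g (x + b)) * cmod (g x) \<partial>lborel) =
        \<bar>\<epsilon>\<bar> ^ DIM('a) *\<^sub>R (\<integral>x. cmod (g (a + \<epsilon> *\<^sub>R x + b)) * cmod (g (a + \<epsilon> *\<^sub>R x)) \<partial>lborel)"
      using \<epsilon> by (intro lborel_integral_affine) auto
    also have "\<dots> = \<epsilon> ^ DIM('a) * (\<integral>x. (1 / \<epsilon> ^ DIM('a)) * (cmod (\<psi> (x + b /\<^sub>R \<epsilon>)) * cmod (\<psi> x)) \<partial>lborel)"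
    proof -
      have "g (a + \<epsilon> *\<^sub>R x) = complex_of_real (1 / sqrt (\<epsilon> ^ DIM('a))) * \<psi> x" for x
        using shift[of x 0] by simp
      moreover have "1 / sqrt (\<epsilon> ^ DIM('a)) * A * (1 / sqrt (\<epsilon> ^ DIM('a)) * B) = 1 / \<epsilon> ^ DIM('a) * (A * B)"
        for A B
        using \<epsilon> by simp
      ultimately show ?thesis
        using \<epsilon> by (simp only: shift norm_mult c) simp
    qed
    finally show ?thesis
      using \<epsilon> by simp
  qed
  then show "(\<integral>x. cmod (g (x + b)) * cmod (g x) \<partial>lborel) = (\<integral>x. cmod (\<psi> (x + b /\<^sub>R \<epsilon>)) * cmod (\<psi> x) \<partial>lborel)" .
  show "L2_norm g = L2_norm \<psi>"
    using eq[of 0] by (simp add: L2_norm_def power2_eq_square)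
qed

lemma
  fixes u :: "'a::euclidean_space \<Rightarrow> complex"
  assumes u: "square_integrable u"
  shows prob_space_density_L2: "L2_norm u = 1 \<Longrightarrow>
      prob_space (density lborel (\<lambda>x. ennreal ((cmod (u x))\<^sup>2)))"
    and integral_density_L2: "f \<in> borel_measurable borel \<Longrightarrow>
      (\<integral>x. f x \<partial>density lborel (\<lambda>x. ennreal ((cmod (u x))\<^sup>2))) =
      (\<integral>x. f x * complex_of_real ((cmod (u x))\<^sup>2) \<partial>lborel)"
proof -
  note [measurable] = square_integrable_measurable[OF u]
  show "prob_space (density lborel (\<lambda>x. ennreal ((cmod (u x))\<^sup>2)))" if "L2_norm u = 1"
    by (rule prob_spaceI) (use L2_sqnorm_eq[OF u] that in \<open>simp add: emeasure_density L2_sqnorm_def\<close>)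
  show "(\<integral>x. f x \<partial>density lborel (\<lambda>x. ennreal ((cmod (u x))\<^sup>2))) =
      (\<integral>x. f x * complex_of_real ((cmod (u x))\<^sup>2) \<partial>lborel)" if [measurable]: "f \<in> borel_measurable borel"
    by (subst integral_density) (simp_all add: scaleR_conv_of_real mult.commute)
qed

theorem schroedinger_measure_tendsto_invariant_mean:
  fixes a :: "'a::euclidean_space" and t :: real and \<rho> :: "'a \<Rightarrow> real"
  assumes t: "t \<noteq> 0"
    and \<rho>: "integrable lborel \<rho>" "AE x in lborel. 0 \<le> \<rho> x"
    and sqrt_\<rho>: "integrable lborel (\<lambda>x. sqrt (\<rho> x))"
    and \<rho>1: "(\<integral>x. \<rho> x \<partial>lborel) = 1"
    and f: "f \<in> almost_periodic"
  shows "((\<lambda>\<epsilon>. \<integral>x. f x \<partial>(schroedinger_measure \<rho> a t \<epsilon>)) \<longlongrightarrow> invariant_mean f) (at_right 0)"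
proof -
  define \<psi> where "\<psi> x = complex_of_real (sqrt (\<rho> x))" for x
  have \<psi>1: "integrable lborel \<psi>"
    unfolding \<psi>_def by (rule integrable_of_real[OF sqrt_\<rho>])
  \<comment> \<open>The real square root is odd, so a negative \<rho> x yields |\<rho> x| here;
    nonnegativity almost everywhere enters only in the integral below.\<close>
  have \<psi>\<rho>: "(cmod (\<psi> x))\<^sup>2 = \<bar>\<rho> x\<bar>" for x
    by (simp add: \<psi>_def flip: real_sqrt_abs2)
  have \<psi>2: "square_integrable \<psi>"
    using \<rho>(1) borel_measurable_integrable[OF \<psi>1] by (simp add: square_integrable_iff \<psi>\<rho>)
  have "(\<integral>x. \<bar>\<rho> x\<bar> \<partial>lborel) = (\<integral>x. \<rho> x \<partial>lborel)"
    using \<rho> by (intro integral_cong_AE) auto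
  then have \<psi>norm: "L2_norm \<psi> = 1"
    by (simp add: L2_norm_def \<psi>\<rho> \<rho>1)
  define u where "u \<epsilon> = schroedinger_group t (\<lambda>y. complex_of_real (sqrt (rescaled \<epsilon> \<rho> (y - a))))" for \<epsilon>
  have u: "square_integrable (u \<epsilon>)" "L2_norm (u \<epsilon>) = 1"
    and char: "cmod (\<integral>x. character \<xi> x * complex_of_real ((cmod (u \<epsilon> x))\<^sup>2) \<partial>lborel) \<le>
        (\<integral>x. cmod (\<psi> (x + ((2 * t) *\<^sub>R \<xi>) /\<^sub>R \<epsilon>)) * cmod (\<psi> x) \<partial>lborel)"
    if \<epsilon>: "0 < \<epsilon>" for \<epsilon> \<xi>
    \<comment> \<open>The general estimates are taken at the dilated profile: its norm is that of
      \<psi>, and \<open>integral_L2_dilation\<close> turns the shift by 2 t \<xi> into one by 2 t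
      \<xi> / \<epsilon>.\<close>
    using square_integrable_schroedinger_group[OF integrable_L2_dilation[OF \<epsilon> \<psi>1 \<psi>2] square_integrable_L2_dilation[OF \<epsilon> \<psi>1 \<psi>2], of t a]
      L2_norm_schroedinger_group[OF integrable_L2_dilation[OF \<epsilon> \<psi>1 \<psi>2] square_integrable_L2_dilation[OF \<epsilon> \<psi>1 \<psi>2], of t a]
      norm_character_schroedinger_group_le[OF integrable_L2_dilation[OF \<epsilon> \<psi>1 \<psi>2] square_integrable_L2_dilation[OF \<epsilon> \<psi>1 \<psi>2], of \<xi> t a]
    unfolding u_def sqrt_rescaled[OF \<epsilon>] character_def integral_L2_dilation[OF \<epsilon> \<psi>1 \<psi>2]
      L2_norm_L2_dilation[OF \<epsilon> \<psi>1 \<psi>2] \<psi>norm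
    unfolding \<psi>_def by blast+
  have \<mu>: "schroedinger_measure \<rho> a t \<epsilon> = density lborel (\<lambda>x. ennreal ((cmod (u \<epsilon> x))\<^sup>2))" for \<epsilon>
    by (simp add: schroedinger_measure_def u_def)
  have pos: "\<forall>\<^sub>F \<epsilon>::real in at_right 0. 0 < \<epsilon>"
    by (simp add: eventually_at_right_less)
  show ?thesis
  proof (rule integral_tendsto_invariant_mean[OF _ _ _ f])
    show "at_right (0::real) \<noteq> bot"
      by simp
    show "\<forall>\<^sub>F \<epsilon> in at_right 0. prob_space (schroedinger_measure \<rho> a t \<epsilon>) \<and>
        sets (schroedinger_measure \<rho> a t \<epsilon>) = sets borel"
      using pos by eventually_elim (simp add: \<mu> prob_space_density_L2 u)
    fix \<xi> :: 'a assume \<xi>: "\<xi> \<noteq> 0"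
    \<comment> \<open>Here t \<noteq> 0 enters: together with \<xi> \<noteq> 0 it makes the length
      of the shift grow without bound.\<close>
    have "filterlim (\<lambda>\<epsilon>::real. (2 * \<bar>t\<bar> * norm \<xi>) * inverse \<epsilon>) at_top (at_right 0)"
      by (rule filterlim_tendsto_pos_mult_at_top[OF tendsto_const _ filterlim_inverse_at_top_right])
        (use t \<xi> in simp)
    moreover have "\<forall>\<^sub>F \<epsilon>::real in at_right 0. (2 * \<bar>t\<bar> * norm \<xi>) * inverse \<epsilon> = norm (((2 * t) *\<^sub>R \<xi>) /\<^sub>R \<epsilon>)"
      using pos by eventually_elim (simp add: abs_mult)
    ultimately have "filterlim (\<lambda>\<epsilon>::real. norm (((2 * t) *\<^sub>R \<xi>) /\<^sub>R \<epsilon>)) at_top (at_right 0)"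
      by (rule filterlim_cong[THEN iffD1, OF refl refl, rotated])
    then have "filterlim (\<lambda>\<epsilon>::real. ((2 * t) *\<^sub>R \<xi>) /\<^sub>R \<epsilon>) at_infinity (at_right 0)"
      by (rule filterlim_norm_at_top_imp_at_infinity)
    from integral_translate_overlap_tendsto_0[OF \<psi>2 this]
    show "((\<lambda>\<epsilon>. \<integral>x. character \<xi> x \<partial>schroedinger_measure \<rho> a t \<epsilon>) \<longlongrightarrow> 0) (at_right 0)"
    proof (rule Lim_null_comparison[rotated])
      show "\<forall>\<^sub>F \<epsilon> in at_right 0. norm (\<integral>x. character \<xi> x \<partial>schroedinger_measure \<rho> a t \<epsilon>) \<le>
          (\<integral>x. cmod (\<psi> (x + ((2 * t) *\<^sub>R \<xi>) /\<^sub>R \<epsilon>)) * cmod (\<psi> x) \<partial>lborel)"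
        using pos
      proof eventually_elim
        case (elim \<epsilon>)
        have "character \<xi> \<in> borel_measurable borel"
          by (intro borel_measurable_continuous_onI continuous_on_character)
        then show ?case
          unfolding \<mu> using char[OF elim] by (simp only: integral_density_L2[OF u(1)[OF elim]])
      qed
    qed
  qed
qed

theorem theorem3p11:
  fixes a :: "real ^ 'n" and t :: real and \<rho> :: "real ^ 'n \<Rightarrow> real"
    and f :: "real ^ 'n \<Rightarrow> complex"
  assumes "t \<noteq> 0"
    and "integrable lborel \<rho>"
    and "AE x in lborel. 0 \<le> \<rho> x"
    and "integrable lborel (\<lambda>x. sqrt (\<rho> x))"
    and "(\<integral>x. \<rho> x \<partial>lborel) = 1"
    and "f \<in> almost_periodic"
  shows "((\<lambda>\<epsilon>. \<integral>x. f x \<partial>(schroedinger_measure \<rho> a t \<epsilon>)) \<longlongrightarrow> invariant_mean f) (at 0 within {0<..1})"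
  \<comment> \<open>The interval (0,1] lies in the positive half line, so the one-sided limit at 0
    restricts to it.\<close>
  using schroedinger_measure_tendsto_invariant_mean[OF assms]
  by (rule tendsto_mono[OF at_le, rotated]) auto

end
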